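(* Let $u\in\mathcal K^g$ be the solution of the variational inequality for the seepage problem and $u_h\in\mathcal K^g_h$ the finite element approximation to $u$. Let $U\in\mathcal V^g$ be the solution of the unrestricted problem, $z\in\mathcal G$ the solution of the dual variational inequality with linear form $J$, and $z_h\in\mathcal W^0_h$ an arbitrary function (all as defined in the context). Suppose the $L^2$ convergence assumption of the context holds. Then, to leading order, $$J(u-u_h)\ \lesssim\ (\mathbf q(u_h)-\mathbf q(U),\nabla(z-z_h)).$$
   Context: Setting. $\Omega\subset\mathbb R^N$ ($N=2$ or $3$) is a bounded, convex, polyhedral domain with outward unit normal $\mathbf n$; its boundary is divided into parts $\Gamma_A,\Gamma_N,\Gamma_D$ whose closures cover $\partial\Omega$. $(\cdot,\cdot)_A$ is the $L^2(A)$ inner product (a boundary integral if $A\subset\partial\Omega$); $(\cdot,\cdot)$ means $A=\Omega$. $h_z$ is the vertical height above a fixed datum, $f$ is a source/sink term, and $k$ is a nonlinear function of the pressure head (the hydraulic conductivity). Set $\mathbf q(v):=-k(v)\nabla(v+h_z)$. Mesh. $\mathcal T$ is a finite subdivision of $\Omega$ into open simplices or open boxes, two distinct elements meeting in a common vertex, edge (or face if $N=3$) or not at all, the closures of the elements covering $\overline\Omega$. The mesh is aligned with $\Gamma_A$: for each $K\in\mathcal T$, $\partial K\cap\partial\Omega$ is either contained in $\Gamma_A$ or meets $\Gamma_A$ in at most one point ($N=2$) or one edge ($N=3$); similarly for $\Gamma_D$. $h$ denotes the mesh size. Spaces. $g$ is affine Dirichlet data on $\Gamma_D$. For $\gamma\in\{g,0\}$,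 with boundary values in the trace sense: $\mathcal V^\gamma=\{v\in H^1(\Omega): v=\gamma\text{ on }\Gamma_D\}$, $\mathcal K^\gamma=\{v\in\mathcal V^\gamma: v\le0\text{ on }\Gamma_A\}$, $\mathcal V^\gamma_h=\{v\in\mathcal V^\gamma: v\text{ has total degree }1\text{ on each }K\in\mathcal T\}$, $\mathcal K^\gamma_h=\{v\in\mathcal V^\gamma_h: v\le0\text{ on }\Gamma_A\}$. The symbol $g$ also denotes the extension of the data to $\Omega$ given by the function in $\mathcal V^g_h$ that vanishes on $\Gamma_A$ and satisfies $(\nabla g,\nabla v_h)=0$ for all $v_h\in\mathcal V^0_h$ vanishing on $\Gamma_A$. Primal problem. $u\in\mathcal K^g$ is the weak solution of: $\nabla\cdot\mathbf q(u)=f$ in $\Omega$, $\mathbf q(u)\cdot\mathbf n=0$ on $\Gamma_N$, $u=g$ on $\Gamma_D$, and $u\le0$, $\mathbf q(u)\cdot\mathbf n\ge0$, $u\,(\mathbf q(u)\cdot\mathbf n)=0$ on $\Gamma_A$. In variational form, $(-\mathbf q(u),\nabla(v+g-u))\ge(f,v+g-u)$ for all $v\in\mathcal K^0$. Discrete problem. $u_h\in\mathcal K^g_h$ satisfies $(-\mathbf q(u_h),\nabla(v_h+g-u_h))\ge(f,v_h+g-u_h)$ for all $v_h\in\mathcal K^0_h$. The discrete contact set is $B_h=\{x\in\Gamma_A: u_h(x)=0\}$, and $\mathcal W^\gamma_h=\{v\in\mathcal V^\gamma_h: v\le0\text{ on }B_h\}$. Unrestricted problem. $U\in\mathcal V^g$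 satisfies $(-\mathbf q(U),\nabla w)=(f,w)$ for all $w\in\mathcal V^0$. Dual problem. $\mathcal G=\{v\in\mathcal V^0: v\le0\text{ on }B_h\text{ and }\int_{\Gamma_A}-\mathbf q(u)\cdot\mathbf n\,(v+u_h)\,dS\le0\}$. $J$ is a linear form, and $z\in\mathcal G$ satisfies $(k(u)\nabla(\varphi-z),\nabla z)\ge J(\varphi-z)$ for all $\varphi\in\mathcal G$. $L^2$ convergence assumption. There are constants $C>0$ and $s>1$ such that $\|u-u_h\|_{L^2(\Omega)}\le Ch^s$. Meaning of "to leading order" and $\lesssim$. In the decomposition $(k(u)\nabla(u-u_h),\nabla z)=(\mathbf q(u_h)-\mathbf q(u),\nabla z)-((k(u)-k(u_h))\nabla(u_h+h_z),\nabla z)$, the last term is, on the basis of the $L^2$ convergence assumption, taken to be of higher order in $u-u_h$ than the first and is neglected. *)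

theory Defs
  imports "HOL-Analysis.Analysis" "HOL-Library.Landau_Symbols"
begin

subsection \<open>Square-integrable functions\<close>

definition L2_space :: "'a measure \<Rightarrow> ('a \<Rightarrow> 'b::euclidean_space) set" where
  "L2_space M = {F. F \<in> borel_measurable M \<and> integrable M (\<lambda>x. (norm (F x))\<^sup>2)}"

definition L2_inner :: "'a measure \<Rightarrow> ('a \<Rightarrow> 'b::euclidean_space) \<Rightarrow> ('a \<Rightarrow> 'b) \<Rightarrow> real" where
  "L2_inner M F G = (\<integral>x. F x \<bullet> G x \<partial>M)"

definition L2_norm :: "'a measure \<Rightarrow> ('a \<Rightarrow> 'b::euclidean_space) \<Rightarrow> real" where
  "L2_norm M F = sqrt (\<integral>x. (norm (F x))\<^sup>2 \<partial>M)"

definition L2_tendsto ::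
    "'a measure \<Rightarrow> (nat \<Rightarrow> 'a \<Rightarrow> 'b::euclidean_space) \<Rightarrow> ('a \<Rightarrow> 'b) \<Rightarrow> bool" where
  "L2_tendsto M F G \<longleftrightarrow> (\<lambda>m. \<integral>\<^sup>+x. ennreal ((norm (F m x - G x))\<^sup>2) \<partial>M) \<longlonglongrightarrow> 0"


subsection \<open>Surface measure\<close>

text \<open>
  The $d$-dimensional Hausdorff measure, normalised so as to agree with Lebesgue measure on
  $d$-dimensional planes ($d \ge 1$). The covering sets must be explicitly bounded, because the
  value of \<^const>\<open>diameter\<close> is unspecified on unbounded sets.
\<close>

definition hausdorff_outer :: "nat \<Rightarrow> 'a::metric_space set \<Rightarrow> ennreal" where
  "hausdorff_outer d A =
     (SUP \<delta>\<in>{0::real<..}.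
        INF U\<in>{U :: nat \<Rightarrow> 'a set. A \<subseteq> (\<Union>i. U i) \<and> (\<forall>i. bounded (U i) \<and> diameter (U i) \<le> \<delta>)}.
          (\<Sum>i. ennreal (unit_ball_vol (real d) * (diameter (U i) / 2) ^ d)))"

definition hausdorff_measure :: "nat \<Rightarrow> 'a::metric_space measure" where
  "hausdorff_measure d = measure_of UNIV (sets borel) (hausdorff_outer d)"

definition surface_measure :: "'a::euclidean_space set \<Rightarrow> 'a measure" where
  "surface_measure \<Omega> = restrict_space (hausdorff_measure (DIM('a) - 1)) (frontier \<Omega>)"


subsection \<open>The Sobolev space $H^1$ and traces\<close>

primrec Ck :: "nat \<Rightarrow> ('a::euclidean_space \<Rightarrow> real) \<Rightarrow> bool" where
  "Ck 0 f \<longleftrightarrow> continuous_on UNIV f"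
| "Ck (Suc m) f \<longleftrightarrow> (\<forall>x. f differentiable (at x)) \<and>
     (\<forall>b\<in>Basis. Ck m (\<lambda>x. frechet_derivative f (at x) b))"

definition test_functions :: "'a::euclidean_space set \<Rightarrow> ('a \<Rightarrow> real) set" where
  "test_functions \<Omega> = {\<phi>. (\<forall>m. Ck m \<phi>) \<and>
     compact (closure {x. \<phi> x \<noteq> 0}) \<and> closure {x. \<phi> x \<noteq> 0} \<subseteq> \<Omega>}"

definition has_weak_gradient ::
    "'a::euclidean_space set \<Rightarrow> ('a \<Rightarrow> real) \<Rightarrow> ('a \<Rightarrow> 'a) \<Rightarrow> bool" where
  "has_weak_gradient \<Omega> v G \<longleftrightarrow>
     (\<forall>\<phi>\<in>test_functions \<Omega>. \<forall>b\<in>Basis.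
        (\<integral>x. v x * frechet_derivative \<phi> (at x) b \<partial>lebesgue_on \<Omega>)
          = - (\<integral>x. (G x \<bullet> b) * \<phi> x \<partial>lebesgue_on \<Omega>))"

definition H1 :: "'a::euclidean_space set \<Rightarrow> ('a \<Rightarrow> real) set" where
  "H1 \<Omega> = {v. v \<in> L2_space (lebesgue_on \<Omega>) \<and>
     (\<exists>G\<in>L2_space (lebesgue_on \<Omega>). has_weak_gradient \<Omega> v G)}"

text \<open>Determined almost everywhere in \<open>\<Omega>\<close> for \<open>v \<in> H1 \<Omega>\<close>.\<close>

definition weak_grad :: "'a::euclidean_space set \<Rightarrow> ('a \<Rightarrow> real) \<Rightarrow> 'a \<Rightarrow> 'a" where
  "weak_grad \<Omega> v = (SOME G. G \<in> L2_space (lebesgue_on \<Omega>) \<and> has_weak_gradient \<Omega> v G)"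

text \<open>
  The trace operator is the continuous extension to $H^1(\Omega)$ of restriction to
  $\partial\Omega$ for functions in $H^1(\Omega) \cap C(\overline\Omega)$; its graph is the closure
  of the graph of that restriction in $H^1(\Omega) \times L^2(\partial\Omega)$. As a
  relation it determines \<open>t\<close> up to surface-null sets, so that \<open>\<exists>t. has_trace \<Omega> v t \<and> \<dots>\<close> below
  speaks about the boundary values of \<open>v\<close>.
\<close>

definition has_trace :: "'a::euclidean_space set \<Rightarrow> ('a \<Rightarrow> real) \<Rightarrow> ('a \<Rightarrow> real) \<Rightarrow> bool" where
  "has_trace \<Omega> v t \<longleftrightarrow> t \<in> borel_measurable (surface_measure \<Omega>) \<and>
     (\<exists>V. (\<forall>m. V m \<in> H1 \<Omega> \<and> continuous_on (closure \<Omega>) (V m)) \<and>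
        L2_tendsto (lebesgue_on \<Omega>) V v \<and>
        L2_tendsto (lebesgue_on \<Omega>) (\<lambda>m. weak_grad \<Omega> (V m)) (weak_grad \<Omega> v) \<and>
        L2_tendsto (surface_measure \<Omega>) V t)"

definition has_weak_divergence ::
    "'a::euclidean_space set \<Rightarrow> ('a \<Rightarrow> 'a) \<Rightarrow> ('a \<Rightarrow> real) \<Rightarrow> bool" where
  "has_weak_divergence \<Omega> F d \<longleftrightarrow>
     (\<forall>\<phi>\<in>test_functions \<Omega>.
        (\<integral>x. frechet_derivative \<phi> (at x) (F x) \<partial>lebesgue_on \<Omega>)
          = - (\<integral>x. d x * \<phi> x \<partial>lebesgue_on \<Omega>))"

text \<open>
  For $F \in L^2$ with weak divergence $d \in L^2$, the outward normal component
  $F \cdot \mathbf n$ on $\partial\Omega$ is defined by Green's formula. The definition says that it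
  is a function \<open>Fn\<close> (and not merely a functional), so that boundary integrals of it make sense.
\<close>

definition has_normal_trace ::
    "'a::euclidean_space set \<Rightarrow> ('a \<Rightarrow> 'a) \<Rightarrow> ('a \<Rightarrow> real) \<Rightarrow> ('a \<Rightarrow> real) \<Rightarrow> bool" where
  "has_normal_trace \<Omega> F d Fn \<longleftrightarrow>
     Fn \<in> borel_measurable (surface_measure \<Omega>) \<and>
     (\<forall>w\<in>H1 \<Omega>. \<forall>t. has_trace \<Omega> w t \<longrightarrow>
        integrable (surface_measure \<Omega>) (\<lambda>x. Fn x * t x) \<and>
        (\<integral>x. Fn x * t x \<partial>surface_measure \<Omega>)
          = L2_inner (lebesgue_on \<Omega>) F (weak_grad \<Omega> w) + L2_inner (lebesgue_on \<Omega>) d w)"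


subsection \<open>Domain, boundary parts and mesh\<close>

definition convex_polyhedral_domain :: "'a::euclidean_space set \<Rightarrow> bool" where
  "convex_polyhedral_domain \<Omega> \<longleftrightarrow>
     open \<Omega> \<and> \<Omega> \<noteq> {} \<and> bounded \<Omega> \<and> convex \<Omega> \<and> polyhedron (closure \<Omega>)"

text \<open>The parts may share surface-null sets, such as the interface of two closed parts.\<close>

definition boundary_parts ::
    "'a::euclidean_space set \<Rightarrow> 'a set \<Rightarrow> 'a set \<Rightarrow> 'a set \<Rightarrow> bool" where
  "boundary_parts \<Omega> \<Gamma>A \<Gamma>N \<Gamma>D \<longleftrightarrow>
     \<Gamma>A \<in> sets borel \<and> \<Gamma>N \<in> sets borel \<and> \<Gamma>D \<in> sets borel \<and>
     closure \<Gamma>A \<union> closure \<Gamma>N \<union> closure \<Gamma>D = frontier \<Omega> \<and>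
     \<Gamma>A \<union> \<Gamma>N \<union> \<Gamma>D \<subseteq> frontier \<Omega> \<and>
     (AE x in surface_measure \<Omega>. x \<in> \<Gamma>A \<union> \<Gamma>N \<union> \<Gamma>D) \<and>
     (AE x in surface_measure \<Omega>. x \<notin> \<Gamma>A \<inter> \<Gamma>N \<and> x \<notin> \<Gamma>A \<inter> \<Gamma>D \<and> x \<notin> \<Gamma>N \<inter> \<Gamma>D)"

definition open_simplex :: "'a::euclidean_space set \<Rightarrow> bool" where
  "open_simplex K \<longleftrightarrow> (\<exists>S. int DIM('a) simplex S \<and> K = interior S)"

text \<open>A box need not be parallel to the coordinate axes.\<close>

definition open_box :: "'a::euclidean_space set \<Rightarrow> bool" where
  "open_box K \<longleftrightarrow> (\<exists>(f :: 'a \<Rightarrow> 'a) a b. orthogonal_transformation f \<and> box a b \<noteq> {} \<and> K = f ` box a b)"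

definition conforming_mesh :: "'a::euclidean_space set \<Rightarrow> 'a set set \<Rightarrow> bool" where
  "conforming_mesh \<Omega> T \<longleftrightarrow>
     finite T \<and> (\<forall>K\<in>T. K \<subseteq> \<Omega> \<and> (open_simplex K \<or> open_box K)) \<and>
     (\<forall>K\<in>T. \<forall>K'\<in>T. K \<noteq> K' \<longrightarrow>
        (closure K \<inter> closure K') face_of closure K \<and> (closure K \<inter> closure K') face_of closure K') \<and>
     (\<Union>K\<in>T. closure K) = closure \<Omega>"

definition aligned_mesh :: "'a::euclidean_space set \<Rightarrow> 'a set set \<Rightarrow> 'a set \<Rightarrow> bool" where
  "aligned_mesh \<Omega> T \<Gamma> \<longleftrightarrow>
     (\<forall>K\<in>T. frontier K \<inter> frontier \<Omega> \<subseteq> \<Gamma> \<or>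
        frontier K \<inter> frontier \<Omega> \<inter> \<Gamma> = {} \<or>
        (\<exists>x. frontier K \<inter> frontier \<Omega> \<inter> \<Gamma> = {x}) \<or>
        (DIM('a) = 3 \<and> (frontier K \<inter> frontier \<Omega> \<inter> \<Gamma>) edge_of closure K))"

definition mesh_size :: "'a::euclidean_space set set \<Rightarrow> real" where
  "mesh_size T = Max (diameter ` T)"


subsection \<open>Function spaces\<close>

definition V_space ::
    "'a::euclidean_space set \<Rightarrow> 'a set \<Rightarrow> ('a \<Rightarrow> real) \<Rightarrow> ('a \<Rightarrow> real) set" where
  "V_space \<Omega> \<Gamma>D \<gamma> = {v \<in> H1 \<Omega>. \<exists>t. has_trace \<Omega> v t \<and>
     (AE x in surface_measure \<Omega>. x \<in> \<Gamma>D \<longrightarrow> t x = \<gamma> x)}"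

definition K_space ::
    "'a::euclidean_space set \<Rightarrow> 'a set \<Rightarrow> 'a set \<Rightarrow> ('a \<Rightarrow> real) \<Rightarrow> ('a \<Rightarrow> real) set" where
  "K_space \<Omega> \<Gamma>A \<Gamma>D \<gamma> = {v \<in> H1 \<Omega>. \<exists>t. has_trace \<Omega> v t \<and>
     (AE x in surface_measure \<Omega>. x \<in> \<Gamma>D \<longrightarrow> t x = \<gamma> x) \<and>
     (AE x in surface_measure \<Omega>. x \<in> \<Gamma>A \<longrightarrow> t x \<le> 0)}"

text \<open>
  A finite element function is represented by its continuous representative on
  $\overline\Omega$. Its trace is then its restriction to $\partial\Omega$, and
  conditions on its boundary values are imposed pointwise.
\<close>

definition Vh_space ::
    "'a::euclidean_space set \<Rightarrow> 'a set \<Rightarrow> 'a set set \<Rightarrow> ('a \<Rightarrow> real) \<Rightarrow> ('a \<Rightarrow> real) set" where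
  "Vh_space \<Omega> \<Gamma>D T \<gamma> = {v \<in> V_space \<Omega> \<Gamma>D \<gamma>. continuous_on (closure \<Omega>) v \<and>
     (\<forall>x\<in>\<Gamma>D. v x = \<gamma> x) \<and> (\<forall>K\<in>T. \<exists>a b. \<forall>x\<in>K. v x = a \<bullet> x + b)}"

definition Kh_space ::
    "'a::euclidean_space set \<Rightarrow> 'a set \<Rightarrow> 'a set \<Rightarrow> 'a set set \<Rightarrow> ('a \<Rightarrow> real) \<Rightarrow> ('a \<Rightarrow> real) set"
  where "Kh_space \<Omega> \<Gamma>A \<Gamma>D T \<gamma> = {v \<in> Vh_space \<Omega> \<Gamma>D T \<gamma>. \<forall>x\<in>\<Gamma>A. v x \<le> 0}"

definition contact_set :: "'a set \<Rightarrow> ('a \<Rightarrow> real) \<Rightarrow> 'a set" where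
  "contact_set \<Gamma>A uh = {x \<in> \<Gamma>A. uh x = 0}"

definition Wh_space ::
    "'a::euclidean_space set \<Rightarrow> 'a set \<Rightarrow> 'a set set \<Rightarrow> 'a set \<Rightarrow> ('a \<Rightarrow> real) \<Rightarrow> ('a \<Rightarrow> real) set"
  where "Wh_space \<Omega> \<Gamma>D T B \<gamma> = {v \<in> Vh_space \<Omega> \<Gamma>D T \<gamma>. \<forall>x\<in>B. v x \<le> 0}"

definition affine_data :: "'a::euclidean_space set \<Rightarrow> ('a \<Rightarrow> real) \<Rightarrow> bool" where
  "affine_data \<Gamma>D g \<longleftrightarrow> (\<exists>a b. \<forall>x\<in>\<Gamma>D. g x = a \<bullet> x + b)"

definition discrete_extension ::
    "'a::euclidean_space set \<Rightarrow> 'a set \<Rightarrow> 'a set \<Rightarrow> 'a set set \<Rightarrow> ('a \<Rightarrow> real) \<Rightarrow> ('a \<Rightarrow> real) \<Rightarrow> bool"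
  where
  "discrete_extension \<Omega> \<Gamma>A \<Gamma>D T gD g \<longleftrightarrow>
     g \<in> Vh_space \<Omega> \<Gamma>D T gD \<and> (\<forall>x\<in>\<Gamma>A. g x = 0) \<and>
     (\<forall>v\<in>Vh_space \<Omega> \<Gamma>D T (\<lambda>_. 0). (\<forall>x\<in>\<Gamma>A. v x = 0) \<longrightarrow>
        L2_inner (lebesgue_on \<Omega>) (weak_grad \<Omega> g) (weak_grad \<Omega> v) = 0)"


subsection \<open>The seepage problem and its discretisation\<close>

definition height :: "'a::euclidean_space \<Rightarrow> real \<Rightarrow> 'a \<Rightarrow> real" where
  "height up datum x = up \<bullet> x - datum"

definition flux ::
    "'a::euclidean_space set \<Rightarrow> (real \<Rightarrow> real) \<Rightarrow> ('a \<Rightarrow> real) \<Rightarrow> ('a \<Rightarrow> real) \<Rightarrow> 'a \<Rightarrow> 'a" where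
  "flux \<Omega> k hz v x = - (k (v x) *\<^sub>R weak_grad \<Omega> (\<lambda>y. v y + hz y) x)"

definition variational_ineq ::
    "'a::euclidean_space set \<Rightarrow> (real \<Rightarrow> real) \<Rightarrow> ('a \<Rightarrow> real) \<Rightarrow> ('a \<Rightarrow> real) \<Rightarrow>
     ('a \<Rightarrow> real) set \<Rightarrow> ('a \<Rightarrow> real) \<Rightarrow> ('a \<Rightarrow> real) \<Rightarrow> bool" where
  "variational_ineq \<Omega> k hz f X g u \<longleftrightarrow>
     (\<forall>v\<in>X. L2_inner (lebesgue_on \<Omega>) (\<lambda>x. - flux \<Omega> k hz u x) (weak_grad \<Omega> (\<lambda>x. v x + g x - u x))
              \<ge> L2_inner (lebesgue_on \<Omega>) f (\<lambda>x. v x + g x - u x))"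

text \<open>
  \<open>qn\<close> is $\mathbf q(u) \cdot \mathbf n$ on $\partial\Omega$. The fluxes are required to be
  square integrable, here and below, so that the weak formulations are meaningful; this is
  automatic for bounded measurable \<open>k\<close>.
\<close>

definition seepage_solution ::
    "'a::euclidean_space set \<Rightarrow> 'a set \<Rightarrow> 'a set \<Rightarrow> 'a set \<Rightarrow> (real \<Rightarrow> real) \<Rightarrow> ('a \<Rightarrow> real) \<Rightarrow>
     ('a \<Rightarrow> real) \<Rightarrow> ('a \<Rightarrow> real) \<Rightarrow> ('a \<Rightarrow> real) \<Rightarrow> ('a \<Rightarrow> real) \<Rightarrow> bool" where
  "seepage_solution \<Omega> \<Gamma>A \<Gamma>N \<Gamma>D k hz f gD u qn \<longleftrightarrow>
     u \<in> K_space \<Omega> \<Gamma>A \<Gamma>D gD \<and>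
     flux \<Omega> k hz u \<in> L2_space (lebesgue_on \<Omega>) \<and>
     has_weak_divergence \<Omega> (flux \<Omega> k hz u) f \<and>
     has_normal_trace \<Omega> (flux \<Omega> k hz u) f qn \<and>
     (AE x in surface_measure \<Omega>. x \<in> \<Gamma>N \<longrightarrow> qn x = 0) \<and>
     (\<exists>t. has_trace \<Omega> u t \<and>
        (AE x in surface_measure \<Omega>. x \<in> \<Gamma>D \<longrightarrow> t x = gD x) \<and>
        (AE x in surface_measure \<Omega>. x \<in> \<Gamma>A \<longrightarrow> t x \<le> 0 \<and> qn x \<ge> 0 \<and> t x * qn x = 0))"

definition discrete_solution ::
    "'a::euclidean_space set \<Rightarrow> 'a set \<Rightarrow> 'a set \<Rightarrow> 'a set set \<Rightarrow> (real \<Rightarrow> real) \<Rightarrow> ('a \<Rightarrow> real) \<Rightarrow>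
     ('a \<Rightarrow> real) \<Rightarrow> ('a \<Rightarrow> real) \<Rightarrow> ('a \<Rightarrow> real) \<Rightarrow> ('a \<Rightarrow> real) \<Rightarrow> bool" where
  "discrete_solution \<Omega> \<Gamma>A \<Gamma>D T k hz f gD g uh \<longleftrightarrow>
     uh \<in> Kh_space \<Omega> \<Gamma>A \<Gamma>D T gD \<and>
     flux \<Omega> k hz uh \<in> L2_space (lebesgue_on \<Omega>) \<and>
     variational_ineq \<Omega> k hz f (Kh_space \<Omega> \<Gamma>A \<Gamma>D T (\<lambda>_. 0)) g uh"

definition unrestricted_solution ::
    "'a::euclidean_space set \<Rightarrow> 'a set \<Rightarrow> (real \<Rightarrow> real) \<Rightarrow> ('a \<Rightarrow> real) \<Rightarrow>
     ('a \<Rightarrow> real) \<Rightarrow> ('a \<Rightarrow> real) \<Rightarrow> ('a \<Rightarrow> real) \<Rightarrow> bool" where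
  "unrestricted_solution \<Omega> \<Gamma>D k hz f gD U \<longleftrightarrow>
     U \<in> V_space \<Omega> \<Gamma>D gD \<and>
     flux \<Omega> k hz U \<in> L2_space (lebesgue_on \<Omega>) \<and>
     (\<forall>w\<in>V_space \<Omega> \<Gamma>D (\<lambda>_. 0).
        L2_inner (lebesgue_on \<Omega>) (\<lambda>x. - flux \<Omega> k hz U x) (weak_grad \<Omega> w)
          = L2_inner (lebesgue_on \<Omega>) f w)"


subsection \<open>The dual problem\<close>

definition G_space ::
    "'a::euclidean_space set \<Rightarrow> 'a set \<Rightarrow> 'a set \<Rightarrow> ('a \<Rightarrow> real) \<Rightarrow> ('a \<Rightarrow> real) \<Rightarrow> ('a \<Rightarrow> real) set"
  where
  "G_space \<Omega> \<Gamma>A \<Gamma>D qn uh = {v \<in> H1 \<Omega>. \<exists>t. has_trace \<Omega> v t \<and>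
     (AE x in surface_measure \<Omega>. x \<in> \<Gamma>D \<longrightarrow> t x = 0) \<and>
     (AE x in surface_measure \<Omega>. x \<in> contact_set \<Gamma>A uh \<longrightarrow> t x \<le> 0) \<and>
     (LINT x:\<Gamma>A|surface_measure \<Omega>. - qn x * (t x + uh x)) \<le> 0}"

definition linear_form_on ::
    "'a::euclidean_space set \<Rightarrow> ('a \<Rightarrow> real) set \<Rightarrow> (('a \<Rightarrow> real) \<Rightarrow> real) \<Rightarrow> bool" where
  "linear_form_on \<Omega> X J \<longleftrightarrow>
     (\<forall>v\<in>X. \<forall>w\<in>X. \<forall>a b. J (\<lambda>x. a * v x + b * w x) = a * J v + b * J w) \<and>
     (\<forall>v\<in>X. \<forall>w\<in>X. (AE x in lebesgue_on \<Omega>. v x = w x) \<longrightarrow> J v = J w)"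

definition dual_solution ::
    "'a::euclidean_space set \<Rightarrow> 'a set \<Rightarrow> 'a set \<Rightarrow> (real \<Rightarrow> real) \<Rightarrow> ('a \<Rightarrow> real) \<Rightarrow> ('a \<Rightarrow> real) \<Rightarrow>
     ('a \<Rightarrow> real) \<Rightarrow> (('a \<Rightarrow> real) \<Rightarrow> real) \<Rightarrow> ('a \<Rightarrow> real) \<Rightarrow> bool" where
  "dual_solution \<Omega> \<Gamma>A \<Gamma>D k u qn uh J z \<longleftrightarrow>
     z \<in> G_space \<Omega> \<Gamma>A \<Gamma>D qn uh \<and>
     (\<forall>\<phi>\<in>G_space \<Omega> \<Gamma>A \<Gamma>D qn uh.
        integrable (lebesgue_on \<Omega>)
          (\<lambda>x. (k (u x) *\<^sub>R weak_grad \<Omega> (\<lambda>y. \<phi> y - z y) x) \<bullet> weak_grad \<Omega> z x) \<and>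
        L2_inner (lebesgue_on \<Omega>)
          (\<lambda>x. k (u x) *\<^sub>R weak_grad \<Omega> (\<lambda>y. \<phi> y - z y) x) (weak_grad \<Omega> z)
          \<ge> J (\<lambda>x. \<phi> x - z x))"


subsection \<open>Leading-order inequalities\<close>

text \<open>
  The two terms of the decomposition
  $(k(u)\nabla(u-u_h),\nabla z)
    = (\mathbf q(u_h)-\mathbf q(u),\nabla z) - ((k(u)-k(u_h))\nabla(u_h+h_z),\nabla z)$.
\<close>

definition principal_term ::
    "'a::euclidean_space set \<Rightarrow> (real \<Rightarrow> real) \<Rightarrow> ('a \<Rightarrow> real) \<Rightarrow> ('a \<Rightarrow> real) \<Rightarrow> ('a \<Rightarrow> real) \<Rightarrow>
     ('a \<Rightarrow> real) \<Rightarrow> real" where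
  "principal_term \<Omega> k hz u uh z =
     L2_inner (lebesgue_on \<Omega>) (\<lambda>x. flux \<Omega> k hz uh x - flux \<Omega> k hz u x) (weak_grad \<Omega> z)"

definition neglected_term ::
    "'a::euclidean_space set \<Rightarrow> (real \<Rightarrow> real) \<Rightarrow> ('a \<Rightarrow> real) \<Rightarrow> ('a \<Rightarrow> real) \<Rightarrow> ('a \<Rightarrow> real) \<Rightarrow>
     ('a \<Rightarrow> real) \<Rightarrow> real" where
  "neglected_term \<Omega> k hz u uh z =
     L2_inner (lebesgue_on \<Omega>)
       (\<lambda>x. (k (u x) - k (uh x)) *\<^sub>R weak_grad \<Omega> (\<lambda>y. uh y + hz y) x) (weak_grad \<Omega> z)"

text \<open>\<open>a \<le> b + o(p)\<close> along \<open>F\<close>\<close>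

definition leading_order_le ::
    "'i filter \<Rightarrow> ('i \<Rightarrow> real) \<Rightarrow> ('i \<Rightarrow> real) \<Rightarrow> ('i \<Rightarrow> real) \<Rightarrow> bool" where
  "leading_order_le F p a b \<longleftrightarrow> (\<forall>c>0. \<forall>\<^sub>F i in F. a i \<le> b i + c * \<bar>p i\<bar>)"

end

theory Submission
  imports Defs "HOL-Computational_Algebra.Polynomial"
begin

text \<open>
  The function $\varphi = z + u - u_h$ is admissible in the dual problem: on \<open>\<Gamma>A\<close> the trace of $u$
  is annihilated by $\mathbf q(u)\cdot\mathbf n$, and $u \le 0 = u_h$ on the contact set. Testing with it
  bounds $J(u - u_h)$ by $(k(u)\nabla(u-u_h),\nabla z)$, the principal term minus the neglected one.
  The estimate exceeds the principal term by
  \[ (\mathbf q(u) - \mathbf q(U), \nabla z) + (\mathbf q(U) - \mathbf q(u_h), \nabla z_h). \]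
  By Green's formula and the equation for $U$, the first summand is the integral of
  $(\mathbf q(u)\cdot\mathbf n)\, z$ over \<open>\<Gamma>A\<close>, which is nonnegative because $z$ satisfies the integral
  constraint of the dual problem and $(\mathbf q(u)\cdot\mathbf n)\, u_h \le 0$. The second is nonnegative
  because $u_h + \varepsilon z_h$ is admissible in the discrete problem for small $\varepsilon > 0$.

  Weak gradients are chosen by \<open>SOME\<close>, so their linearity needs uniqueness almost everywhere, hence
  the fundamental lemma of the calculus of variations and a supply of smooth bump functions.
\<close>

subsection \<open>Smooth bump functions and the fundamental lemma\<close>

text \<open>The argument is exact on each single mesh: \<open>err i \<le> est i - negl i\<close>,
  the slack being a sum of two terms of known sign. Leading order enters only at the end. The L^2
  rate bounds \<open>negl\<close> through the Lipschitz constant of \<open>k\<close>, but it gives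
  no lower bound for the principal term, so \<open>negl \<in> o[h_to_0](prin)\<close> stays a
  hypothesis of the last conjunct.

  The step that shapes the proof is the admissibility of a small multiple of \<open>zh\<close>. Near
  the contact set \<open>uh\<close> may be negative but arbitrarily close to 0 while
  \<open>zh\<close> is positive, so compactness alone yields no step length. A uniform one comes
  from finiteness: an aligned mesh on a polyhedral domain cuts \<open>\<Gamma>A\<close> into
  finitely many polytopes on which both functions are affine.

  Since \<open>flux\<close> differentiates \<open>v + hz\<close> as a whole, comparing two fluxes
  requires the height to lie in H^1, hence integration by parts for affine functions. Boundary
  values are a relation, so sign conditions are always carried together with the trace that
  witnesses them.\<close>

lemma Ck_const: "Ck m (\<lambda>x. c)"
  by (induction m arbitrary: c) (auto simp: frechet_derivative_const)

lemma Ck_SucI: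
  assumes "\<And>x. (f has_derivative D x) (at x)" "\<And>b. b \<in> Basis \<Longrightarrow> Ck m (\<lambda>x. D x b)"
  shows "Ck (Suc m) f"
proof -
  have "frechet_derivative f (at x) = D x" for x
    using frechet_derivative_at[OF assms(1)] by simp
  then show ?thesis
    using assms by (auto simp: differentiable_def)
qed

lemma Ck_Suc_has_derivative:
  "Ck (Suc m) f \<Longrightarrow> (f has_derivative frechet_derivative f (at x)) (at x)"
  by (simp add: frechet_derivative_works)

lemma Ck_Suc_imp_Ck: "Ck (Suc m) f \<Longrightarrow> Ck m f"
proof (induction m arbitrary: f)
  case 0
  then show ?case
    by (auto simp: continuous_on_eq_continuous_within differentiable_imp_continuous_within)
next
  case (Suc m)
  then show ?case
    by (metis Ck.simps(2))
qed

lemma Ck_add: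
  assumes "Ck m f" "Ck m g"
  shows "Ck m (\<lambda>x. f x + g x)"
  using assms
proof (induction m arbitrary: f g)
  case 0
  then show ?case by (auto intro: continuous_intros)
next
  case (Suc m)
  show ?case
  proof (rule Ck_SucI)
    show "((\<lambda>x. f x + g x) has_derivative
        (\<lambda>h. frechet_derivative f (at x) h + frechet_derivative g (at x) h)) (at x)" for x
      by (intro has_derivative_add Ck_Suc_has_derivative[OF Suc.prems(1)]
          Ck_Suc_has_derivative[OF Suc.prems(2)])
  qed (use Suc in auto)
qed

lemma Ck_mult:
  assumes "Ck m f" "Ck m g"
  shows "Ck m (\<lambda>x. f x * g x)"
  using assms
proof (induction m arbitrary: f g)
  case 0
  then show ?case by (auto intro: continuous_intros)
next
  case (Suc m)
  show ?case
  proof (rule Ck_SucI)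
    show "((\<lambda>x. f x * g x) has_derivative
        (\<lambda>h. f x * frechet_derivative g (at x) h + frechet_derivative f (at x) h * g x)) (at x)" for x
      by (intro has_derivative_mult Ck_Suc_has_derivative[OF Suc.prems(1)]
          Ck_Suc_has_derivative[OF Suc.prems(2)])
  next
    fix b :: 'a assume "b \<in> Basis"
    then show "Ck m (\<lambda>x. f x * frechet_derivative g (at x) b + frechet_derivative f (at x) b * g x)"
      using Suc Ck_Suc_imp_Ck[OF Suc.prems(1)] Ck_Suc_imp_Ck[OF Suc.prems(2)]
      by (intro Ck_add Suc.IH) auto
  qed
qed

lemma Ck_diff: "Ck m f \<Longrightarrow> Ck m g \<Longrightarrow> Ck m (\<lambda>x. f x - g x)"
  using Ck_add[of m f "\<lambda>x. (-1) * g x"] Ck_mult[OF Ck_const[of m "-1"], of g] by simp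

lemma Ck_power: "Ck m f \<Longrightarrow> Ck m (\<lambda>x. f x ^ n)"
  by (induction n) (auto intro: Ck_const Ck_mult)

lemma Ck_prod: "(\<And>i. i \<in> I \<Longrightarrow> Ck m (f i)) \<Longrightarrow> Ck m (\<lambda>x. \<Prod>i\<in>I. f i x)"
  by (induction I rule: infinite_finite_induct) (auto intro: Ck_const Ck_mult)

text \<open>Functions p(1/t) exp(-1/t), continued by zero. The polynomial is a parameter because the
  family is then closed under differentiation, and smoothness of every order becomes one
  induction.\<close>

definition flat_exp :: "real poly \<Rightarrow> real \<Rightarrow> real" where
  "flat_exp p t = (if t > 0 then poly p (1 / t) * exp (- (1 / t)) else 0)"

lemma poly_over_exp_tendsto_0: "((\<lambda>s::real. poly p s * exp (- s)) \<longlongrightarrow> 0) at_top"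
proof -
  have "((\<lambda>s::real. \<Sum>i\<le>degree p. coeff p i * (s ^ i / exp s)) \<longlongrightarrow> (\<Sum>i\<le>degree p. coeff p i * 0)) at_top"
    by (intro tendsto_intros tendsto_power_div_exp_0)
  then show ?thesis
    by (simp add: poly_altdef exp_minus divide_inverse sum_distrib_right mult.assoc)
qed

text \<open>With s = 1/t one has d/dt = -s^2 d/ds, which takes p(s) exp(-s) to s^2 (p - p')(s)
  exp(-s); this explains the polynomial \<open>monom 1 2 * (p - pderiv p)\<close>.\<close>

lemma flat_exp_has_derivative:
  "(flat_exp p has_real_derivative flat_exp (monom 1 2 * (p - pderiv p)) t) (at t)"
proof (cases t "0::real" rule: linorder_cases)
  case less
  have "((\<lambda>_. 0) has_real_derivative 0) (at t)"
    by simp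
  moreover have "eventually (\<lambda>y. y \<in> {..<0}) (nhds t)"
    using less by (intro eventually_nhds_in_open) auto
  then have "eventually (\<lambda>y. flat_exp p y = 0) (nhds t)"
    by eventually_elim (simp add: flat_exp_def)
  ultimately show ?thesis
    using less DERIV_cong_ev[of t t "flat_exp p" "\<lambda>_. 0" 0 0] by (simp add: flat_exp_def)
next
  case equal
  \<comment> \<open>At t = 0 the right difference quotient p(1/h) exp(-1/h) / h equals s p(s)
    exp(-s) with s = 1/h, and \<open>pCons 0 p\<close> is the polynomial s p(s).\<close>
  have "((\<lambda>h. poly (pCons 0 p) (inverse h) * exp (- inverse h)) \<longlongrightarrow> 0) (at_right 0)"
    using poly_over_exp_tendsto_0 filterlim_inverse_at_top_right by (rule filterlim_compose)
  then have "((\<lambda>h. flat_exp p h / h) \<longlongrightarrow> 0) (at_right 0)"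
    by (rule Lim_transform_eventually)
      (auto simp: eventually_at_filter flat_exp_def divide_inverse)
  moreover have "((\<lambda>h. flat_exp p h / h) \<longlongrightarrow> 0) (at_left 0)"
    by (rule Lim_transform_eventually[OF tendsto_const])
      (auto simp: eventually_at_filter flat_exp_def)
  ultimately have "((\<lambda>h. flat_exp p h / h) \<longlongrightarrow> 0) (at 0)"
    by (rule filterlim_split_at_real[rotated])
  then show ?thesis
    using equal by (simp add: DERIV_def flat_exp_def)
next
  case greater
  have "((\<lambda>t. poly p (1 / t) * exp (- (1 / t))) has_real_derivative
      flat_exp (monom 1 2 * (p - pderiv p)) t) (at t)"
    using greater
    by (auto intro!: derivative_eq_intros DERIV_chain2[OF poly_DERIV]
        simp: flat_exp_def poly_monom field_simps power2_eq_square)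
  moreover have "eventually (\<lambda>y. y \<in> {0<..}) (nhds t)"
    using greater by (intro eventually_nhds_in_open) auto
  then have "eventually (\<lambda>y. flat_exp p y = poly p (1 / y) * exp (- (1 / y))) (nhds t)"
    by eventually_elim (simp add: flat_exp_def)
  ultimately show ?thesis
    by (subst DERIV_cong_ev[OF refl _ refl]) auto
qed

text \<open>Under the chain rule an affine argument only contributes the constant factor
  \<open>v \<bullet> b\<close>, so the induction closes as long as \<open>p\<close> is left
  arbitrary.\<close>

lemma Ck_flat_exp_affine: "Ck m (\<lambda>x. flat_exp p (v \<bullet> x + \<beta>))"
proof (induction m arbitrary: p)
  case 0
  have "continuous_on UNIV (flat_exp p)"
    by (meson DERIV_isCont continuous_at_imp_continuous_on flat_exp_has_derivative)
  then show ?case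
    by (auto intro!: continuous_on_compose2[of UNIV "flat_exp p"] continuous_intros)
next
  case (Suc m)
  show ?case
  proof (rule Ck_SucI)
    show "((\<lambda>x. flat_exp p (v \<bullet> x + \<beta>)) has_derivative
        (\<lambda>d. flat_exp (monom 1 2 * (p - pderiv p)) (v \<bullet> x + \<beta>) * (v \<bullet> d))) (at x)" for x
      by (rule has_derivative_compose[of "\<lambda>x. v \<bullet> x + \<beta>" "\<lambda>d. v \<bullet> d" x UNIV "flat_exp p",
            OF _ flat_exp_has_derivative[unfolded has_field_derivative_def]])
        (auto intro!: derivative_eq_intros)
  qed (intro Ck_mult Suc.IH Ck_const)
qed

text \<open>One factor for each face of the box: exp(-1/t), cut off at t = 0, applied to the signed
  distance from that face.\<close>

definition bump :: "'a::euclidean_space \<Rightarrow> 'a \<Rightarrow> 'a \<Rightarrow> real" where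
  "bump a c x = (\<Prod>b\<in>Basis. flat_exp 1 (b \<bullet> x + - (a \<bullet> b)) * flat_exp 1 ((- b) \<bullet> x + c \<bullet> b))"

lemma Ck_bump: "Ck m (bump a c)"
  unfolding bump_def by (intro Ck_prod Ck_mult Ck_flat_exp_affine)

lemma bump_bounds: "0 \<le> bump a c x" "bump a c x \<le> 1"
  unfolding bump_def
  by (auto intro!: prod_nonneg prod_le_1 mult_le_one simp: flat_exp_def)

lemma bump_eq_0_iff: "bump a c x = 0 \<longleftrightarrow> x \<notin> box a c"
  by (auto simp: bump_def flat_exp_def mem_box inner_commute not_less) (meson not_less)+

text \<open>\<open>1 - (1 - bump a c)\<^sup>m\<close> increases to the indicator of the open box.\<close>

lemma approx_indicator_test_function:
  assumes "cbox a c \<subseteq> \<Omega>"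
  shows "(\<lambda>x. 1 - (1 - bump a c x) ^ Suc m) \<in> test_functions \<Omega>"
proof -
  have "{x. 1 - (1 - bump a c x) ^ Suc m \<noteq> 0} \<subseteq> cbox a c"
    using bump_eq_0_iff[of a c] box_subset_cbox[of a c] by force
  then have "closure {x. 1 - (1 - bump a c x) ^ Suc m \<noteq> 0} \<subseteq> cbox a c"
    by (rule closure_minimal) (rule closed_cbox)
  moreover from this have "compact (closure {x. 1 - (1 - bump a c x) ^ Suc m \<noteq> 0})"
    by (meson bounded_cbox bounded_subset closed_closure compact_eq_bounded_closed)
  ultimately show ?thesis
    using assms unfolding test_functions_def
    by (auto intro!: Ck_diff Ck_power Ck_const Ck_bump simp del: power_Suc)
qed

lemma approx_indicator_tendsto:
  "(\<lambda>m. 1 - (1 - bump a c x) ^ Suc m) \<longlonglongrightarrow> indicat_real (box a c) x"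
proof (cases "x \<in> box a c")
  case True
  then have "(\<lambda>m. (1 - bump a c x) ^ Suc m) \<longlonglongrightarrow> 0"
    using bump_bounds[of a c x] bump_eq_0_iff[of a c x]
    by (intro LIMSEQ_Suc LIMSEQ_power_zero) auto
  from tendsto_diff[OF tendsto_const[of 1] this] show ?thesis
    using True by simp
next
  case False
  then show ?thesis using bump_eq_0_iff[of a c x] by simp
qed

text \<open>The approximants of the indicator take values in [0,1], so
  \<open>\<bar>g x\<bar>\<close> dominates and the limit may be taken under the integral. The closed
  box has to lie in \<open>\<Omega>\<close> because it contains the closed supports of the
  approximants.\<close>

lemma integral_over_box_eq_0:
  fixes g :: "'a::euclidean_space \<Rightarrow> real"
  assumes \<Omega>: "\<Omega> \<in> sets lebesgue" and g: "integrable (lebesgue_on \<Omega>) g"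
    and test: "\<And>\<phi>. \<phi> \<in> test_functions \<Omega> \<Longrightarrow> (\<integral>x. g x * \<phi> x \<partial>lebesgue_on \<Omega>) = 0"
    and box: "cbox a c \<subseteq> \<Omega>"
  shows "(\<integral>x. g x * indicator (box a c) x \<partial>lebesgue_on \<Omega>) = 0"
proof -
  have ev: "(1 - bump a c x) ^ n \<in> {0..1}" for x n
    using bump_bounds[of a c x] by (auto intro: power_le_one)
  have "continuous_on UNIV (bump a c)"
    using Ck_bump[of 0 a c] by simp
  then have [measurable]: "bump a c \<in> borel_measurable (lebesgue_on \<Omega>)"
    by (metis continuous_imp_measurable_on_sets_lebesgue continuous_on_subset \<Omega> subset_UNIV)
  have box': "box a c \<inter> space (lebesgue_on \<Omega>) \<in> sets (lebesgue_on \<Omega>)"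
    using \<Omega> by (simp add: sets_restrict_space_iff sets.Int lmeasurable_box)
  have "(\<lambda>m. \<integral>x. g x * (1 - (1 - bump a c x) ^ Suc m) \<partial>lebesgue_on \<Omega>)
      \<longlonglongrightarrow> (\<integral>x. g x * indicator (box a c) x \<partial>lebesgue_on \<Omega>)"
  proof (rule integral_dominated_convergence[where w = "\<lambda>x. \<bar>g x\<bar>"])
    show "AE x in lebesgue_on \<Omega>. norm (g x * (1 - (1 - bump a c x) ^ Suc m)) \<le> \<bar>g x\<bar>" for m
      using ev[of _ "Suc m"]
      by (intro AE_I2) (auto simp: abs_mult intro!: mult_left_le simp del: power_Suc)
    show "AE x in lebesgue_on \<Omega>. (\<lambda>m. g x * (1 - (1 - bump a c x) ^ Suc m))
        \<longlonglongrightarrow> g x * indicator (box a c) x"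
      by (intro AE_I2 tendsto_mult tendsto_const approx_indicator_tendsto)
      show "(\<lambda>x. g x * indicator (box a c) x) \<in> borel_measurable (lebesgue_on \<Omega>)"
      using g box' by (intro borel_measurable_times) (simp_all add: borel_measurable_indicator_iff)
  qed (use g in auto)
  then show ?thesis
    using test[OF approx_indicator_test_function[OF box]] by (simp add: LIMSEQ_const_iff)
qed

text \<open>Fundamental lemma of the calculus of variations, by Lebesgue differentiation: the
  averages of \<open>g\<close>, extended by zero, over small cubes inside \<open>\<Omega>\<close>
  are all zero, and at almost every point they converge to the value of \<open>g\<close>.\<close>

lemma AE_eq_0_if_test_integrals_0:
  fixes g :: "'a::euclidean_space \<Rightarrow> real"
  assumes \<Omega>: "open \<Omega>" and g: "integrable (lebesgue_on \<Omega>) g"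
    and test: "\<And>\<phi>. \<phi> \<in> test_functions \<Omega> \<Longrightarrow> (\<integral>x. g x * \<phi> x \<partial>lebesgue_on \<Omega>) = 0"
  shows "AE x in lebesgue_on \<Omega>. g x = 0"
proof -
  have [simp]: "\<Omega> \<in> sets lebesgue" using \<Omega> by simp
  define G where "G = (\<lambda>x. if x \<in> \<Omega> then g x else 0)"
  have G: "integrable lebesgue G"
    unfolding G_def using g by (simp add: Lebesgue_Measure.integrable_restrict_UNIV)
  have Gset: "set_integrable lebesgue S G" if "S \<in> sets lebesgue" for S
    using that G unfolding set_integrable_def by (rule integrable_mult_indicator)
  then have Gon: "G absolutely_integrable_on cbox a c" for a c
    by (simp add: Gset)
  have zero: "integral (cbox a c) G = 0" if "cbox a c \<subseteq> \<Omega>" for a c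
  proof -
    \<comment> \<open>Lebesgue differentiation averages over closed boxes, while the bump functions
      single out open ones; the faces carry no mass.\<close>
    have "integral (cbox a c) G = integral (box a c) G"
      by (simp add: integral_open_interval)
    also have "\<dots> = (LINT x:box a c|lebesgue. G x)"
      by (intro set_lebesgue_integral_eq_integral(2)[symmetric] Gset) simp
    also have "\<dots> = (\<integral>x. (if x \<in> \<Omega> then g x * indicator (box a c) x else 0) \<partial>lebesgue)"
      unfolding set_lebesgue_integral_def
      by (intro Bochner_Integration.integral_cong) (auto simp: G_def)
    also have "\<dots> = (\<integral>x. g x * indicator (box a c) x \<partial>lebesgue_on \<Omega>)"
      by (simp add: Lebesgue_Measure.integral_restrict_UNIV)
    also have "\<dots> = 0"
      using integral_over_box_eq_0[OF _ g test that] by simp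
    finally show ?thesis .
  qed
  obtain N where N: "negligible N"
    "\<And>x e. \<lbrakk>x \<notin> N; 0 < e\<rbrakk> \<Longrightarrow>
      \<exists>d>0. \<forall>h. 0 < h \<and> h < d \<longrightarrow> norm (integral (cbox x (x + h *\<^sub>R One)) G /\<^sub>R h ^ DIM('a) - G x) < e"
    using integrable_ccontinuous_explicit[of G] Gon set_lebesgue_integral_eq_integral(1)
    by metis
  have "g x = 0" if x: "x \<in> \<Omega>" "x \<notin> N" for x
  proof (rule ccontr)
    assume "g x \<noteq> 0"
    then obtain d where d: "d > 0" "\<And>h. 0 < h \<Longrightarrow> h < d \<Longrightarrow>
        norm (integral (cbox x (x + h *\<^sub>R One)) G /\<^sub>R h ^ DIM('a) - G x) < \<bar>g x\<bar>"
      using N(2)[OF x(2), of "\<bar>g x\<bar>"] by auto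
    obtain r where r: "r > 0" "cball x r \<subseteq> \<Omega>"
      using \<Omega> x(1) open_contains_cball by blast
    \<comment> \<open>\<open>d / 2\<close> keeps \<open>h\<close> strictly below \<open>d\<close>.
      The divisor \<open>DIM('a)\<close> comes from the l1 bound on the norm: the cube with corner
      \<open>x\<close> and edge \<open>h\<close> stays within distance \<open>h * DIM('a)\<close> of
      \<open>x\<close>.\<close>
    define h where "h = min (d / 2) (r / DIM('a))"
    have h: "h > 0" "h < d" "h * DIM('a) \<le> r"
      using d(1) r(1) unfolding h_def by (auto simp: min_def field_simps)
    have "cbox x (x + h *\<^sub>R One) \<subseteq> cball x r"
    proof
      fix y assume y: "y \<in> cbox x (x + h *\<^sub>R One)"
      have "norm (y - x) \<le> (\<Sum>b\<in>Basis. \<bar>(y - x) \<bullet> b\<bar>)"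
        by (rule norm_le_l1)
      also have "\<dots> \<le> (\<Sum>b\<in>(Basis::'a set). h)"
        using y by (intro sum_mono) (force simp: mem_box inner_simps abs_le_iff)
      also have "\<dots> \<le> r" using h(3) by (simp add: mult.commute)
      finally show "y \<in> cball x r" by (simp add: dist_norm norm_minus_commute)
    qed
    then have "integral (cbox x (x + h *\<^sub>R One)) G = 0"
      using r zero by blast
    then show False
      using d(2)[OF h(1,2)] x by (simp add: G_def)
  qed
  then have "AE x in lebesgue. x \<in> \<Omega> \<longrightarrow> g x = 0"
    using N(1) by (intro AE_I'[of N]) (auto simp: negligible_iff_null_sets)
  then show ?thesis
    by (simp add: AE_restrict_space_iff)
qed

subsection \<open>Calculus of weak gradients and traces\<close>

lemma L2_space_measurable: "F \<in> L2_space M \<Longrightarrow> F \<in> borel_measurable M"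
  by (simp add: L2_space_def)

lemma L2_space_inner_integrable:
  assumes "F \<in> L2_space M" "G \<in> L2_space M"
  shows "integrable M (\<lambda>x. F x \<bullet> G x)"
proof (rule Bochner_Integration.integrable_bound)
  show "integrable M (\<lambda>x. (norm (F x))\<^sup>2 + (norm (G x))\<^sup>2)"
    using assms by (auto simp: L2_space_def)
  show "(\<lambda>x. F x \<bullet> G x) \<in> borel_measurable M"
    using assms by (auto simp: L2_space_def)
  have "\<bar>a \<bullet> b\<bar> \<le> (norm a)\<^sup>2 + (norm b)\<^sup>2" for a b :: 'b
  proof -
    have "2 * (norm a * norm b) \<le> (norm a)\<^sup>2 + (norm b)\<^sup>2"
      using sum_squares_bound[of "norm a" "norm b"] by simp
    moreover have "0 \<le> norm a * norm b" by simp
    ultimately show ?thesis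
      using Cauchy_Schwarz_ineq2[of a b] by linarith
  qed
  then show "AE x in M. norm (F x \<bullet> G x) \<le> norm ((norm (F x))\<^sup>2 + (norm (G x))\<^sup>2)"
    by simp
qed

lemma power2_norm_lincomb_le:
  "(norm (a *\<^sub>R x + b *\<^sub>R y))\<^sup>2 \<le> 2 * a\<^sup>2 * (norm x)\<^sup>2 + 2 * b\<^sup>2 * (norm y)\<^sup>2"
proof -
  have "(norm (a *\<^sub>R x + b *\<^sub>R y))\<^sup>2 \<le> (\<bar>a\<bar> * norm x + \<bar>b\<bar> * norm y)\<^sup>2"
    using norm_triangle_ineq[of "a *\<^sub>R x" "b *\<^sub>R y"] by (intro power_mono) auto
  also have "\<dots> \<le> 2 * (\<bar>a\<bar> * norm x)\<^sup>2 + 2 * (\<bar>b\<bar> * norm y)\<^sup>2"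
    using sum_squares_bound[of "\<bar>a\<bar> * norm x" "\<bar>b\<bar> * norm y"] by (simp add: power2_sum)
  finally show ?thesis by (simp add: power_mult_distrib)
qed

lemma L2_space_lincomb:
  assumes "F \<in> L2_space M" "G \<in> L2_space M"
  shows "(\<lambda>x. a *\<^sub>R F x + b *\<^sub>R G x) \<in> L2_space M"
proof -
  have [measurable]: "F \<in> borel_measurable M" "G \<in> borel_measurable M"
    using assms by (auto simp: L2_space_def)
  have "integrable M (\<lambda>x. (norm (a *\<^sub>R F x + b *\<^sub>R G x))\<^sup>2)"
  proof (rule Bochner_Integration.integrable_bound)
    show "integrable M (\<lambda>x. 2 * a\<^sup>2 * (norm (F x))\<^sup>2 + 2 * b\<^sup>2 * (norm (G x))\<^sup>2)"
      using assms by (auto simp: L2_space_def)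
  qed (auto intro!: AE_I2 power2_norm_lincomb_le[THEN order_trans])
  then show ?thesis
    by (simp add: L2_space_def)
qed

lemma bounded_in_L2_space:
  assumes "finite_measure M" "F \<in> borel_measurable M" "\<And>x. norm (F x) \<le> B"
  shows "F \<in> L2_space M"
proof -
  interpret finite_measure M by fact
  have "integrable M (\<lambda>x. (norm (F x))\<^sup>2)"
    using assms(2,3) by (intro integrable_const_bound[of _ "B\<^sup>2"]) (auto intro!: power_mono)
  then show ?thesis
    using assms by (simp add: L2_space_def)
qed

lemma L2_tendsto_lincomb:
  assumes "L2_tendsto M F f" "L2_tendsto M G g"
    and [measurable]: "\<And>m. F m \<in> borel_measurable M" "\<And>m. G m \<in> borel_measurable M"
      "f \<in> borel_measurable M" "g \<in> borel_measurable M"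
  shows "L2_tendsto M (\<lambda>m x. a *\<^sub>R F m x + b *\<^sub>R G m x) (\<lambda>x. a *\<^sub>R f x + b *\<^sub>R g x)"
proof -
  define If where "If m = (\<integral>\<^sup>+x. ennreal ((norm (F m x - f x))\<^sup>2) \<partial>M)" for m
  define Ig where "Ig m = (\<integral>\<^sup>+x. ennreal ((norm (G m x - g x))\<^sup>2) \<partial>M)" for m
  have le: "(\<integral>\<^sup>+x. ennreal ((norm (a *\<^sub>R F m x + b *\<^sub>R G m x - (a *\<^sub>R f x + b *\<^sub>R g x)))\<^sup>2) \<partial>M)
      \<le> ennreal (2 * a\<^sup>2) * If m + ennreal (2 * b\<^sup>2) * Ig m" for m
  proof -
    have "(norm (a *\<^sub>R F m x + b *\<^sub>R G m x - (a *\<^sub>R f x + b *\<^sub>R g x)))\<^sup>2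
        \<le> 2 * a\<^sup>2 * (norm (F m x - f x))\<^sup>2 + 2 * b\<^sup>2 * (norm (G m x - g x))\<^sup>2" for x
      using power2_norm_lincomb_le[of a "F m x - f x" b "G m x - g x"] by (simp add: algebra_simps)
    then have "(\<integral>\<^sup>+x. ennreal ((norm (a *\<^sub>R F m x + b *\<^sub>R G m x - (a *\<^sub>R f x + b *\<^sub>R g x)))\<^sup>2) \<partial>M)
      \<le> (\<integral>\<^sup>+x. ennreal (2 * a\<^sup>2) * ennreal ((norm (F m x - f x))\<^sup>2)
              + ennreal (2 * b\<^sup>2) * ennreal ((norm (G m x - g x))\<^sup>2) \<partial>M)"
      by (intro nn_integral_mono) (simp flip: ennreal_mult ennreal_plus)
    also have "\<dots> = ennreal (2 * a\<^sup>2) * If m + ennreal (2 * b\<^sup>2) * Ig m"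
      unfolding If_def Ig_def by (subst nn_integral_add) (auto simp: nn_integral_cmult)
    finally show ?thesis .
  qed
  have "(\<lambda>m. ennreal (2 * a\<^sup>2) * If m + ennreal (2 * b\<^sup>2) * Ig m)
      \<longlonglongrightarrow> ennreal (2 * a\<^sup>2) * 0 + ennreal (2 * b\<^sup>2) * 0"
    using assms(1,2) unfolding L2_tendsto_def If_def Ig_def
    by (intro tendsto_add ennreal_tendsto_cmult) auto
  then have "(\<lambda>m. ennreal (2 * a\<^sup>2) * If m + ennreal (2 * b\<^sup>2) * Ig m) \<longlonglongrightarrow> 0"
    by simp
  then show ?thesis
    unfolding L2_tendsto_def
    by (rule tendsto_sandwich[OF _ _ tendsto_const, rotated 2]) (use le in auto)
qed

lemma L2_tendsto_cong_AE:
  assumes "L2_tendsto M F f" "\<And>m. AE x in M. F m x = G m x" "AE x in M. f x = g x"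
  shows "L2_tendsto M G g"
proof -
  have "(\<integral>\<^sup>+x. ennreal ((norm (F m x - f x))\<^sup>2) \<partial>M) = (\<integral>\<^sup>+x. ennreal ((norm (G m x - g x))\<^sup>2) \<partial>M)" for m
    using assms(2)[of m] assms(3) by (intro nn_integral_cong_AE) auto
  then show ?thesis
    using assms(1) by (simp add: L2_tendsto_def)
qed

lemma L2_tendsto_const: "L2_tendsto M (\<lambda>_. f) f"
  by (simp add: L2_tendsto_def)

section \<open>Test functions, uniqueness and linearity of weak gradients\<close>

lemma frechet_derivative_eq_0_outside_support:
  assumes "x \<notin> closure {x. \<phi> x \<noteq> 0}"
  shows "frechet_derivative \<phi> (at x) = (\<lambda>_. 0)"
proof -
  have "((\<lambda>_. 0) has_derivative (\<lambda>_. 0)) (at x)"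
    by simp
  then have "(\<phi> has_derivative (\<lambda>_. 0)) (at x)"
    by (rule has_derivative_transform_within_open[of _ _ _ _ "- closure {x. \<phi> x \<noteq> 0}"])
      (use assms closure_subset[of "{x. \<phi> x \<noteq> 0}"] in auto)
  then show ?thesis
    using frechet_derivative_at by metis
qed

lemma continuous_compact_support_bounded:
  fixes f :: "'a::metric_space \<Rightarrow> real"
  assumes "continuous_on UNIV f" "compact S" "\<And>x. x \<notin> S \<Longrightarrow> f x = 0"
  obtains B where "B \<ge> 0" "\<And>x. \<bar>f x\<bar> \<le> B"
proof -
  have "bounded (f ` S)"
    using assms(1,2) continuous_on_subset compact_continuous_image compact_imp_bounded by blast
  then obtain B where "\<forall>y\<in>f ` S. norm y \<le> B" "B > 0"
    using bounded_pos by blast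
  then have "\<bar>f x\<bar> \<le> B" for x
    using assms(3) by (cases "x \<in> S") auto
  then show thesis
    using that[of B] \<open>B > 0\<close> by auto
qed

lemma test_function_facts:
  assumes "\<phi> \<in> test_functions \<Omega>"
  shows "(\<phi> has_derivative frechet_derivative \<phi> (at x)) (at x)"
    "continuous_on UNIV \<phi>" "b \<in> Basis \<Longrightarrow> continuous_on UNIV (\<lambda>x. frechet_derivative \<phi> (at x) b)"
proof -
  have "Ck 0 \<phi>" "Ck (Suc 0) \<phi>"
    using assms unfolding test_functions_def by blast+
  then show "(\<phi> has_derivative frechet_derivative \<phi> (at x)) (at x)"
    "continuous_on UNIV \<phi>" "b \<in> Basis \<Longrightarrow> continuous_on UNIV (\<lambda>x. frechet_derivative \<phi> (at x) b)"
    by (auto simp: frechet_derivative_works)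
qed

lemma finite_measure_lebesgue_on_bounded:
  "open \<Omega> \<Longrightarrow> bounded \<Omega> \<Longrightarrow> finite_measure (lebesgue_on \<Omega>)"
  by (intro finite_measure_lebesgue_on) (simp add: bounded_set_imp_lmeasurable)

lemma continuous_compact_support_in_L2:
  fixes f :: "'a::euclidean_space \<Rightarrow> real"
  assumes "open \<Omega>" "bounded \<Omega>" "continuous_on UNIV f" "compact S" "\<And>x. x \<notin> S \<Longrightarrow> f x = 0"
  shows "f \<in> L2_space (lebesgue_on \<Omega>)"
proof -
  obtain B where "\<And>x. \<bar>f x\<bar> \<le> B"
    using continuous_compact_support_bounded assms by blast
  moreover have "f \<in> borel_measurable (lebesgue_on \<Omega>)"
    using assms by (metis continuous_imp_measurable_on_sets_lebesgue continuous_on_subset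
        lborelD sets_completionI_sets subset_UNIV borel_open)
  ultimately show ?thesis
    using assms by (intro bounded_in_L2_space finite_measure_lebesgue_on_bounded) auto
qed

lemma test_function_in_L2:
  assumes "open \<Omega>" "bounded \<Omega>" "\<phi> \<in> test_functions \<Omega>"
  shows "\<phi> \<in> L2_space (lebesgue_on \<Omega>)"
    "b \<in> Basis \<Longrightarrow> (\<lambda>x. frechet_derivative \<phi> (at x) b) \<in> L2_space (lebesgue_on \<Omega>)"
proof -
  let ?S = "closure {x. \<phi> x \<noteq> 0}"
  have "compact ?S"
    using assms(3) by (simp add: test_functions_def)
  moreover have "\<phi> x = 0" if "x \<notin> ?S" for x
    using that closure_subset[of "{x. \<phi> x \<noteq> 0}"] by auto
  ultimately show "\<phi> \<in> L2_space (lebesgue_on \<Omega>)"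
    using test_function_facts[OF assms(3)] by (intro continuous_compact_support_in_L2[OF assms(1,2), of _ ?S])
  assume "b \<in> Basis"
  with \<open>compact ?S\<close> show "(\<lambda>x. frechet_derivative \<phi> (at x) b) \<in> L2_space (lebesgue_on \<Omega>)"
    using test_function_facts(3)[OF assms(3)]
    by (intro continuous_compact_support_in_L2[OF assms(1,2), of _ ?S])
      (simp_all add: frechet_derivative_eq_0_outside_support)
qed

lemma has_weak_gradient_unique:
  fixes \<Omega> :: "'a::euclidean_space set"
  assumes \<Omega>: "open \<Omega>" "bounded \<Omega>"
    and G: "G \<in> L2_space (lebesgue_on \<Omega>)" "has_weak_gradient \<Omega> v G"
    and H: "H \<in> L2_space (lebesgue_on \<Omega>)" "has_weak_gradient \<Omega> v H"
  shows "AE x in lebesgue_on \<Omega>. G x = H x"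
proof -
  have "AE x in lebesgue_on \<Omega>. (G x - H x) \<bullet> b = 0" if b: "b \<in> Basis" for b
  proof (rule AE_eq_0_if_test_integrals_0[OF \<Omega>(1)])
    \<comment> \<open>On a bounded domain constants are square integrable, so the components of an
      L^2 field are integrable, as the fundamental lemma requires.\<close>
    have "(\<lambda>_. b) \<in> L2_space (lebesgue_on \<Omega>)"
      using \<Omega> by (intro bounded_in_L2_space[of _ _ "norm b"] finite_measure_lebesgue_on_bounded) auto
    then have Gb: "integrable (lebesgue_on \<Omega>) (\<lambda>x. G x \<bullet> b)" "integrable (lebesgue_on \<Omega>) (\<lambda>x. H x \<bullet> b)"
      using G(1) H(1) by (auto intro: L2_space_inner_integrable)
    then show "integrable (lebesgue_on \<Omega>) (\<lambda>x. (G x - H x) \<bullet> b)"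
      by (simp add: inner_diff_left)
    fix \<phi> assume \<phi>: "\<phi> \<in> test_functions \<Omega>"
    have "(\<lambda>x. \<phi> x *\<^sub>R b) \<in> L2_space (lebesgue_on \<Omega>)"
      using test_function_in_L2(1)[OF \<Omega> \<phi>] b by (auto simp: L2_space_def)
    from L2_space_inner_integrable[OF G(1) this] L2_space_inner_integrable[OF H(1) this]
    have "integrable (lebesgue_on \<Omega>) (\<lambda>x. \<phi> x * (G x \<bullet> b))"
      "integrable (lebesgue_on \<Omega>) (\<lambda>x. \<phi> x * (H x \<bullet> b))"
      by auto
    then have "(\<integral>x. (G x - H x) \<bullet> b * \<phi> x \<partial>lebesgue_on \<Omega>)
        = (\<integral>x. G x \<bullet> b * \<phi> x \<partial>lebesgue_on \<Omega>) - (\<integral>x. H x \<bullet> b * \<phi> x \<partial>lebesgue_on \<Omega>)"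
      by (simp add: inner_diff_left left_diff_distrib right_diff_distrib mult.commute)
    also have "\<dots> = 0"
      using G(2) H(2) \<phi> b unfolding has_weak_gradient_def by fastforce
    finally show "(\<integral>x. (G x - H x) \<bullet> b * \<phi> x \<partial>lebesgue_on \<Omega>) = 0" .
  qed
  then have "AE x in lebesgue_on \<Omega>. \<forall>b\<in>Basis. (G x - H x) \<bullet> b = 0"
    by (intro AE_finite_allI) auto
  then show ?thesis
    by eventually_elim (auto simp: euclidean_eq_iff[of "G _"] inner_diff_left)
qed

lemma weak_grad_H1:
  assumes "v \<in> H1 \<Omega>"
  shows "weak_grad \<Omega> v \<in> L2_space (lebesgue_on \<Omega>)" "has_weak_gradient \<Omega> v (weak_grad \<Omega> v)"
proof -
  have "\<exists>G. G \<in> L2_space (lebesgue_on \<Omega>) \<and> has_weak_gradient \<Omega> v G"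
    using assms by (auto simp: H1_def)
  from someI_ex[OF this]
  have "weak_grad \<Omega> v \<in> L2_space (lebesgue_on \<Omega>) \<and> has_weak_gradient \<Omega> v (weak_grad \<Omega> v)"
    by (simp add: weak_grad_def)
  then show "weak_grad \<Omega> v \<in> L2_space (lebesgue_on \<Omega>)" "has_weak_gradient \<Omega> v (weak_grad \<Omega> v)"
    by auto
qed

lemma has_weak_gradient_lincomb:
  fixes \<Omega> :: "'a::euclidean_space set"
  assumes \<Omega>: "open \<Omega>" "bounded \<Omega>"
    and v: "v \<in> L2_space (lebesgue_on \<Omega>)" "G \<in> L2_space (lebesgue_on \<Omega>)" "has_weak_gradient \<Omega> v G"
    and w: "w \<in> L2_space (lebesgue_on \<Omega>)" "H \<in> L2_space (lebesgue_on \<Omega>)" "has_weak_gradient \<Omega> w H"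
  shows "has_weak_gradient \<Omega> (\<lambda>x. a * v x + c * w x) (\<lambda>x. a *\<^sub>R G x + c *\<^sub>R H x)"
  unfolding has_weak_gradient_def
proof (intro ballI)
  fix \<phi> :: "'a \<Rightarrow> real" and b :: 'a assume \<phi>: "\<phi> \<in> test_functions \<Omega>" and b: "b \<in> Basis"
  let ?d = "\<lambda>x. frechet_derivative \<phi> (at x) b"
  have "(\<lambda>x. \<phi> x *\<^sub>R b) \<in> L2_space (lebesgue_on \<Omega>)"
    using test_function_in_L2(1)[OF \<Omega> \<phi>] b by (auto simp: L2_space_def)
  from L2_space_inner_integrable[OF v(2) this] L2_space_inner_integrable[OF w(2) this]
  have GH: "integrable (lebesgue_on \<Omega>) (\<lambda>x. \<phi> x * (G x \<bullet> b))"
    "integrable (lebesgue_on \<Omega>) (\<lambda>x. \<phi> x * (H x \<bullet> b))"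
    by auto
  from L2_space_inner_integrable[OF v(1) test_function_in_L2(2)[OF \<Omega> \<phi> b]]
    L2_space_inner_integrable[OF w(1) test_function_in_L2(2)[OF \<Omega> \<phi> b]]
  have vw: "integrable (lebesgue_on \<Omega>) (\<lambda>x. v x * ?d x)" "integrable (lebesgue_on \<Omega>) (\<lambda>x. w x * ?d x)"
    by auto
  have "(\<integral>x. (a * v x + c * w x) * ?d x \<partial>lebesgue_on \<Omega>)
      = (\<integral>x. a * (v x * ?d x) + c * (w x * ?d x) \<partial>lebesgue_on \<Omega>)"
    by (simp add: algebra_simps)
  also have "\<dots> = a * (\<integral>x. v x * ?d x \<partial>lebesgue_on \<Omega>) + c * (\<integral>x. w x * ?d x \<partial>lebesgue_on \<Omega>)"
    using vw by simp
  also have "\<dots> = a * - (\<integral>x. \<phi> x * (G x \<bullet> b) \<partial>lebesgue_on \<Omega>) + c * - (\<integral>x. \<phi> x * (H x \<bullet> b) \<partial>lebesgue_on \<Omega>)"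
    using v(3) w(3) \<phi> b by (simp add: has_weak_gradient_def mult.commute)
  also have "\<dots> = - (\<integral>x. a * (\<phi> x * (G x \<bullet> b)) + c * (\<phi> x * (H x \<bullet> b)) \<partial>lebesgue_on \<Omega>)"
    using GH by simp
  also have "\<dots> = - (\<integral>x. (a *\<^sub>R G x + c *\<^sub>R H x) \<bullet> b * \<phi> x \<partial>lebesgue_on \<Omega>)"
    by (simp add: algebra_simps inner_simps)
  finally show "(\<integral>x. (a * v x + c * w x) * ?d x \<partial>lebesgue_on \<Omega>)
      = - (\<integral>x. (a *\<^sub>R G x + c *\<^sub>R H x) \<bullet> b * \<phi> x \<partial>lebesgue_on \<Omega>)" .
qed

lemma H1_lincomb:
  fixes \<Omega> :: "'a::euclidean_space set"
  assumes \<Omega>: "open \<Omega>" "bounded \<Omega>" and v: "v \<in> H1 \<Omega>" and w: "w \<in> H1 \<Omega>"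
  shows "(\<lambda>x. a * v x + c * w x) \<in> H1 \<Omega>"
    and weak_grad_lincomb: "AE x in lebesgue_on \<Omega>.
      weak_grad \<Omega> (\<lambda>x. a * v x + c * w x) x = a *\<^sub>R weak_grad \<Omega> v x + c *\<^sub>R weak_grad \<Omega> w x"
proof -
  have vw: "v \<in> L2_space (lebesgue_on \<Omega>)" "w \<in> L2_space (lebesgue_on \<Omega>)"
    using v w by (auto simp: H1_def)
  have g: "has_weak_gradient \<Omega> (\<lambda>x. a * v x + c * w x) (\<lambda>x. a *\<^sub>R weak_grad \<Omega> v x + c *\<^sub>R weak_grad \<Omega> w x)"
    by (intro has_weak_gradient_lincomb \<Omega> vw weak_grad_H1 v w)
  have L: "(\<lambda>x. a *\<^sub>R weak_grad \<Omega> v x + c *\<^sub>R weak_grad \<Omega> w x) \<in> L2_space (lebesgue_on \<Omega>)"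
    by (intro L2_space_lincomb weak_grad_H1 v w)
  show H: "(\<lambda>x. a * v x + c * w x) \<in> H1 \<Omega>"
    using L2_space_lincomb[OF vw] g L by (auto simp: H1_def)
  show "AE x in lebesgue_on \<Omega>.
      weak_grad \<Omega> (\<lambda>x. a * v x + c * w x) x = a *\<^sub>R weak_grad \<Omega> v x + c *\<^sub>R weak_grad \<Omega> w x"
    by (intro has_weak_gradient_unique[OF \<Omega> _ _ L g] weak_grad_H1 H)
qed

lemma continuous_surface_measurable:
  assumes "continuous_on (closure \<Omega>) (f :: 'a::euclidean_space \<Rightarrow> real)"
  shows "f \<in> borel_measurable (surface_measure \<Omega>)"
proof -
  \<comment> \<open>\<open>measure_of\<close> keeps the sigma-algebra it is given, so measurability
    on the boundary is Borel measurability, whatever the values of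
    \<open>hausdorff_outer\<close>.\<close>
  have "sets (surface_measure \<Omega>) = sets (restrict_space borel (frontier \<Omega>))"
    unfolding surface_measure_def hausdorff_measure_def
    by (intro sets_restrict_space_cong) (metis sets.sets_measure_of_eq space_borel)
  moreover have "continuous_on (frontier \<Omega>) f"
    using assms by (rule continuous_on_subset) (simp add: frontier_def)
  ultimately show ?thesis
    using borel_measurable_continuous_on_restrict measurable_cong_sets by blast
qed

lemma has_trace_lincomb:
  fixes \<Omega> :: "'a::euclidean_space set"
  assumes \<Omega>: "open \<Omega>" "bounded \<Omega>" and v: "v \<in> H1 \<Omega>" "has_trace \<Omega> v s"
    and w: "w \<in> H1 \<Omega>" "has_trace \<Omega> w t"
  shows "has_trace \<Omega> (\<lambda>x. a * v x + c * w x) (\<lambda>x. a * s x + c * t x)"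
proof -
  obtain V where V: "\<And>m. V m \<in> H1 \<Omega>" "\<And>m. continuous_on (closure \<Omega>) (V m)"
    "L2_tendsto (lebesgue_on \<Omega>) V v"
    "L2_tendsto (lebesgue_on \<Omega>) (\<lambda>m. weak_grad \<Omega> (V m)) (weak_grad \<Omega> v)"
    "L2_tendsto (surface_measure \<Omega>) V s"
    using v(2) unfolding has_trace_def by blast
  obtain W where W: "\<And>m. W m \<in> H1 \<Omega>" "\<And>m. continuous_on (closure \<Omega>) (W m)"
    "L2_tendsto (lebesgue_on \<Omega>) W w"
    "L2_tendsto (lebesgue_on \<Omega>) (\<lambda>m. weak_grad \<Omega> (W m)) (weak_grad \<Omega> w)"
    "L2_tendsto (surface_measure \<Omega>) W t"
    using w(2) unfolding has_trace_def by blast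
  have meas: "s \<in> borel_measurable (surface_measure \<Omega>)" "t \<in> borel_measurable (surface_measure \<Omega>)"
    using v w by (auto simp: has_trace_def)
  have L2: "f \<in> borel_measurable (lebesgue_on \<Omega>)" "weak_grad \<Omega> f \<in> borel_measurable (lebesgue_on \<Omega>)"
    if "f \<in> H1 \<Omega>" for f
    using that weak_grad_H1[OF that] by (auto simp: H1_def L2_space_def)
  show ?thesis
    unfolding has_trace_def
  proof (intro conjI exI[of _ "\<lambda>m x. a * V m x + c * W m x"] allI)
    show "(\<lambda>x. a * s x + c * t x) \<in> borel_measurable (surface_measure \<Omega>)"
      using meas by auto
    show "L2_tendsto (lebesgue_on \<Omega>) (\<lambda>m x. a * V m x + c * W m x) (\<lambda>x. a * v x + c * w x)"
      using L2_tendsto_lincomb[OF V(3) W(3)] V W v w L2 by simp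
    show "L2_tendsto (surface_measure \<Omega>) (\<lambda>m x. a * V m x + c * W m x) (\<lambda>x. a * s x + c * t x)"
      using L2_tendsto_lincomb[OF V(5) W(5) continuous_surface_measurable[OF V(2)]
          continuous_surface_measurable[OF W(2)] meas, of a c] by simp
    \<comment> \<open>The gradients of the combined approximants are choices of their own, equal to
      the combined gradients only almost everywhere; convergence is proved for the latter and then
      transferred.\<close>
    have "L2_tendsto (lebesgue_on \<Omega>) (\<lambda>m x. a *\<^sub>R weak_grad \<Omega> (V m) x + c *\<^sub>R weak_grad \<Omega> (W m) x)
        (\<lambda>x. a *\<^sub>R weak_grad \<Omega> v x + c *\<^sub>R weak_grad \<Omega> w x)"
      using V W v w L2 by (intro L2_tendsto_lincomb) auto
    then show "L2_tendsto (lebesgue_on \<Omega>) (\<lambda>m. weak_grad \<Omega> (\<lambda>x. a * V m x + c * W m x))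
        (weak_grad \<Omega> (\<lambda>x. a * v x + c * w x))"
      by (rule L2_tendsto_cong_AE)
        (auto simp: V W v w \<Omega> intro!: AE_symmetric[OF weak_grad_lincomb])
  qed (use V W \<Omega> in \<open>auto intro!: H1_lincomb continuous_intros\<close>)
qed

text \<open>A constant sequence approximates. This makes every finite element function its own
  trace.\<close>

lemma continuous_has_trace:
  assumes "v \<in> H1 \<Omega>" "continuous_on (closure \<Omega>) v"
  shows "has_trace \<Omega> v v"
  using assms continuous_surface_measurable
  unfolding has_trace_def by (intro conjI exI[of _ "\<lambda>_. v"]) (auto simp: L2_tendsto_const)

section \<open>Integration by parts for affine functions\<close>

lemma integral_partial_derivative_eq_0:
  fixes \<psi> :: "'a::euclidean_space \<Rightarrow> real"
  assumes der: "\<And>x. (\<psi> has_derivative D x) (at x)" and cont: "continuous_on UNIV (\<lambda>x. D x b)"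
    and b: "norm b \<le> 1" and S: "compact S" "\<And>x. x \<notin> S \<Longrightarrow> \<psi> x = 0" "\<And>x. x \<notin> S \<Longrightarrow> D x b = 0"
  shows "(\<integral>x. D x b \<partial>lborel) = 0"
proof -
  obtain M where M: "M \<ge> 0" "\<And>x. \<bar>D x b\<bar> \<le> M"
    using continuous_compact_support_bounded[OF cont S(1,3)] by blast
  obtain R where R: "\<And>x. x \<in> S \<Longrightarrow> norm x \<le> R"
    using compact_imp_bounded[OF S(1)] by (auto simp: bounded_iff)
  have cont\<psi>: "continuous_on UNIV \<psi>"
    using der by (meson continuous_at_imp_continuous_on has_derivative_continuous)
  then have [measurable]: "\<psi> \<in> borel_measurable borel"
    by (rule borel_measurable_continuous_onI)
  have [measurable]: "(\<lambda>x. D x b) \<in> borel_measurable borel"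
    using cont by (rule borel_measurable_continuous_onI)
  define t where "t n = 1 / real (Suc n)" for n
  have t: "0 < t n" "t n \<le> 1" for n
    by (auto simp: t_def)
  define q where "q n x = (\<psi> (x + t n *\<^sub>R b) - \<psi> x) / t n" for n x
  have line: "((\<lambda>s. \<psi> (x + s *\<^sub>R b)) has_real_derivative D (x + s *\<^sub>R b) b) (at s)" for x s
  proof -
    have "((\<lambda>s. \<psi> (x + s *\<^sub>R b)) has_derivative (\<lambda>h. D (x + s *\<^sub>R b) (h *\<^sub>R b))) (at s)"
      by (rule has_derivative_compose[OF _ der]) (auto intro!: derivative_eq_intros)
    moreover have "linear (D (x + s *\<^sub>R b))"
      using der has_derivative_linear by blast
    then have "(\<lambda>h. D (x + s *\<^sub>R b) (h *\<^sub>R b)) = (*) (D (x + s *\<^sub>R b) b)"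
      by (auto simp: linear_cmul)
    ultimately show ?thesis
      by (simp add: has_field_derivative_def)
  qed
  have "integrable lborel (\<lambda>x. indicator S x *\<^sub>R \<psi> x)"
    using S(1) cont\<psi> by (intro borel_integrable_compact) (auto intro: continuous_on_subset)
  moreover have "(\<lambda>x. indicator S x *\<^sub>R \<psi> x) = \<psi>"
    using S(2) by (auto simp: indicator_def fun_eq_iff)
  ultimately have int\<psi>: "integrable lborel \<psi>"
    by simp
  \<comment> \<open>Translation invariance of Lebesgue measure: each difference quotient of
    \<open>\<psi>\<close> has integral zero, and the derivative inherits this in the limit.\<close>
  have shift: "integral\<^sup>L lborel (\<lambda>x. \<psi> (x + c)) = integral\<^sup>L lborel \<psi>"
    "integrable lborel (\<lambda>x. \<psi> (x + c))" for c
    using integral_distr[of "(+) c" lborel borel \<psi>] integrable_distr_eq[of "(+) c" lborel borel \<psi>] int\<psi>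
    by (simp_all add: lborel_distr_plus add.commute)
  have "(\<lambda>n. integral\<^sup>L lborel (q n)) \<longlonglongrightarrow> (\<integral>x. D x b \<partial>lborel)"
  \<comment> \<open>By the mean value theorem a quotient is a value of the derivative, hence at most
    \<open>M\<close> in absolute value. As \<open>t n\<close> and the norm of \<open>b\<close> are
    at most 1, it vanishes outside the support enlarged by 1, which gives the radius
    \<open>R + 1\<close>.\<close>
  proof (rule integral_dominated_convergence[where w = "\<lambda>x. M * indicator (cball 0 (R + 1)) x"])
    show "integrable lborel (\<lambda>x::'a. M * indicator (cball 0 (R + 1)) x)"
      using emeasure_bounded_finite[of "cball (0::'a) (R + 1)"]
      by (intro integrable_mult_right integrable_real_indicator) auto
    show "AE x in lborel. (\<lambda>n. q n x) \<longlonglongrightarrow> D x b"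
    proof (rule AE_I2)
      fix x
      have "((\<lambda>h. (\<psi> (x + h *\<^sub>R b) - \<psi> x) / h) \<longlongrightarrow> D x b) (at 0)"
        using line[of x 0] by (simp add: DERIV_def)
      moreover have "filterlim t (at 0) sequentially"
        unfolding t_def using t(1) LIMSEQ_Suc[OF lim_1_over_n]
        by (auto simp: filterlim_at)
      ultimately show "(\<lambda>n. q n x) \<longlonglongrightarrow> D x b"
        unfolding q_def by (rule filterlim_compose)
    qed
    show "AE x in lborel. norm (q n x) \<le> M * indicator (cball 0 (R + 1)) x" for n
    proof (rule AE_I2)
      fix x
      show "norm (q n x) \<le> M * indicator (cball 0 (R + 1)) x"
      proof (cases "x \<in> cball 0 (R + 1)")
        case True
        obtain z where "\<psi> (x + t n *\<^sub>R b) - \<psi> (x + 0 *\<^sub>R b) = (t n - 0) * D (x + z *\<^sub>R b) b"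
          using MVT2[OF t(1)[of n], of "\<lambda>s. \<psi> (x + s *\<^sub>R b)" "\<lambda>s. D (x + s *\<^sub>R b) b"] line by blast
        then have "q n x = D (x + z *\<^sub>R b) b"
          using t(1)[of n] by (simp add: q_def)
        then show ?thesis using True M(2) by simp
      next
        case False
        have "norm (t n *\<^sub>R b) \<le> 1"
          using t[of n] b by (simp add: mult_le_one)
        then have "norm (x + t n *\<^sub>R b) > R"
          using False norm_triangle_ineq4[of "x + t n *\<^sub>R b" "t n *\<^sub>R b"] by simp
        moreover have "norm x > R"
          using False by simp
        ultimately have "x \<notin> S" "x + t n *\<^sub>R b \<notin> S"
          using R by fastforce+
        then show ?thesis using S(2) False by (simp add: q_def)
      qed
    qed
  qed (unfold q_def, measurable)
  moreover have "integral\<^sup>L lborel (q n) = 0" for n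
    unfolding q_def using shift[of "t n *\<^sub>R b"] shift(2)[of 0] by simp
  ultimately show ?thesis
    by (simp add: LIMSEQ_const_iff)
qed

text \<open>The product of the affine function with the test function has compact support in
  \<open>\<Omega>\<close>, so its partial derivatives integrate to zero; the product rule splits
  this integral into the two sides of the claim.\<close>

lemma affine_has_weak_gradient:
  fixes \<Omega> :: "'a::euclidean_space set"
  assumes \<Omega>: "open \<Omega>" "bounded \<Omega>"
  shows "has_weak_gradient \<Omega> (\<lambda>x. p \<bullet> x + c) (\<lambda>_. p)"
  unfolding has_weak_gradient_def
proof (intro ballI)
  fix \<phi> :: "'a \<Rightarrow> real" and b :: 'a assume \<phi>: "\<phi> \<in> test_functions \<Omega>" and b: "b \<in> Basis"
  define S where "S = closure {x. \<phi> x \<noteq> 0}"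
  have S: "compact S" "S \<subseteq> \<Omega>"
    using \<phi> by (auto simp: test_functions_def S_def)
  have supp: "\<phi> x = 0" "frechet_derivative \<phi> (at x) = (\<lambda>_. 0)" if "x \<notin> S" for x
    using that closure_subset[of "{x. \<phi> x \<noteq> 0}"] frechet_derivative_eq_0_outside_support[of x \<phi>]
    by (auto simp: S_def)
  define D where "D x d = (p \<bullet> x + c) * frechet_derivative \<phi> (at x) d + (p \<bullet> d) * \<phi> x" for x d
  have cont: "continuous_on UNIV (\<lambda>x. D x b)"
    unfolding D_def using test_function_facts[OF \<phi>] b by (intro continuous_intros) auto
  have "(\<integral>x. D x b \<partial>lborel) = 0"
  proof (rule integral_partial_derivative_eq_0[where \<psi> = "\<lambda>x. (p \<bullet> x + c) * \<phi> x"])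
    have "((\<lambda>x. p \<bullet> x + c) has_derivative (\<lambda>d. p \<bullet> d)) (at x)" for x
      by (auto intro!: derivative_eq_intros)
    then show "((\<lambda>x. (p \<bullet> x + c) * \<phi> x) has_derivative D x) (at x)" for x
      unfolding D_def by (intro has_derivative_mult test_function_facts(1)[OF \<phi>])
  qed (use S b cont supp in \<open>auto simp: D_def\<close>)
  then have "0 = (\<integral>x. D x b \<partial>lebesgue)"
    using cont by (simp add: integral_completion borel_measurable_continuous_onI)
  also have "\<dots> = (\<integral>x. (if x \<in> \<Omega> then D x b else 0) \<partial>lebesgue)"
  proof (intro Bochner_Integration.integral_cong)
    fix x
    show "D x b = (if x \<in> \<Omega> then D x b else 0)"
      using supp[of x] S(2) by (cases "x \<in> S") (auto simp: D_def)
  qed simp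
  also have "\<dots> = (\<integral>x. D x b \<partial>lebesgue_on \<Omega>)"
    using \<Omega> by (simp add: Lebesgue_Measure.integral_restrict_UNIV)
  also have "\<dots> = (\<integral>x. (p \<bullet> x + c) * frechet_derivative \<phi> (at x) b \<partial>lebesgue_on \<Omega>)
      + (\<integral>x. (p \<bullet> b) * \<phi> x \<partial>lebesgue_on \<Omega>)"
  proof -
    have "(\<lambda>x. (p \<bullet> x + c) * frechet_derivative \<phi> (at x) b) \<in> L2_space (lebesgue_on \<Omega>)"
      "(\<lambda>x. (p \<bullet> b) * \<phi> x) \<in> L2_space (lebesgue_on \<Omega>)"
      using test_function_facts[OF \<phi>] b supp
      by (auto intro!: continuous_compact_support_in_L2[OF \<Omega> _ S(1)] continuous_intros)
    \<comment> \<open>Pairing with the constant 1 turns square integrability on the bounded domain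
      into integrability.\<close>
    moreover have "(\<lambda>_. 1::real) \<in> L2_space (lebesgue_on \<Omega>)"
      using \<Omega> by (intro bounded_in_L2_space[of _ _ 1] finite_measure_lebesgue_on_bounded) auto
    ultimately show ?thesis
      unfolding D_def using L2_space_inner_integrable[of "\<lambda>_. 1::real" "lebesgue_on \<Omega>"]
      by (intro Bochner_Integration.integral_add) force+
  qed
  finally show "(\<integral>x. (p \<bullet> x + c) * frechet_derivative \<phi> (at x) b \<partial>lebesgue_on \<Omega>)
      = - (\<integral>x. p \<bullet> b * \<phi> x \<partial>lebesgue_on \<Omega>)"
    by simp
qed

lemma affine_in_H1:
  fixes \<Omega> :: "'a::euclidean_space set"
  assumes \<Omega>: "open \<Omega>" "bounded \<Omega>"
  shows "(\<lambda>x. p \<bullet> x + c) \<in> H1 \<Omega>"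
proof -
  obtain B where B: "\<And>x. x \<in> \<Omega> \<Longrightarrow> norm x \<le> B"
    using \<Omega>(2) by (auto simp: bounded_iff)
  have fin: "finite_measure (lebesgue_on \<Omega>)"
    using \<Omega> by (rule finite_measure_lebesgue_on_bounded)
  interpret finite_measure "lebesgue_on \<Omega>" by (rule fin)
  have "(\<lambda>_. p) \<in> L2_space (lebesgue_on \<Omega>)"
    by (intro bounded_in_L2_space[OF fin]) auto
  moreover have meas: "(\<lambda>x. p \<bullet> x + c) \<in> borel_measurable (lebesgue_on \<Omega>)"
    using \<Omega> by (intro continuous_imp_measurable_on_sets_lebesgue continuous_intros) auto
  have "integrable (lebesgue_on \<Omega>) (\<lambda>x. (norm (p \<bullet> x + c))\<^sup>2)"
  proof (rule integrable_const_bound[of _ "(norm p * B + \<bar>c\<bar>)\<^sup>2"])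
    have "\<bar>p \<bullet> x + c\<bar> \<le> norm p * B + \<bar>c\<bar>" if "x \<in> \<Omega>" for x
      using Cauchy_Schwarz_ineq2[of p x] mult_left_mono[OF B[OF that], of "norm p"] by simp
    then have "(norm (p \<bullet> x + c))\<^sup>2 \<le> (norm p * B + \<bar>c\<bar>)\<^sup>2" if "x \<in> \<Omega>" for x
      using that by (intro power_mono) auto
    then show "AE x in lebesgue_on \<Omega>. norm ((norm (p \<bullet> x + c))\<^sup>2) \<le> (norm p * B + \<bar>c\<bar>)\<^sup>2"
      by (intro AE_I2) simp
  qed (use meas in measurable)
  ultimately show ?thesis
    using meas affine_has_weak_gradient[OF \<Omega>] by (auto simp: H1_def L2_space_def intro!: exI[of _ "\<lambda>_. p"])
qed

subsection \<open>Perturbation of finite element functions\<close>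

lemma polytope_closure_cell:
  fixes K :: "'a::euclidean_space set"
  assumes "open_simplex K \<or> open_box K"
  shows "polytope (closure K)"
  using assms
proof
  assume "open_simplex K"
  then obtain S where S: "int DIM('a) simplex S" "K = interior S"
    by (auto simp: open_simplex_def)
  \<comment> \<open>Either alternative suffices: an empty interior would make the cell the empty
    polytope, and otherwise its closure is the simplex itself.\<close>
  have "interior S = {} \<or> closure (interior S) = S"
    using S(1) by (metis closed_simplex closure_closed convex_closure_interior convex_simplex)
  then show ?thesis
    using S simplex_imp_polytope polytope_empty by (metis closure_empty)
next
  assume "open_box K"
  then obtain f :: "'a \<Rightarrow> 'a" and a b where f: "orthogonal_transformation f" "box a b \<noteq> {}" "K = f ` box a b"
    by (auto simp: open_box_def)
  have "linear f" "inj f"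
    using f(1) orthogonal_transformation_linear orthogonal_transformation_inj by auto
  then have "closure K = f ` cbox a b"
    using closure_injective_linear_image[of f "box a b"] f by simp
  then show ?thesis
    using polytope_linear_image[OF \<open>linear f\<close> polytope_interval] by simp
qed

lemma open_cell: "open_simplex K \<or> open_box K \<Longrightarrow> open (K :: 'a::euclidean_space set)"
proof (elim disjE)
  assume "open_box K"
  then obtain f :: "'a \<Rightarrow> 'a" and a b where "orthogonal_transformation f" "K = f ` box a b"
    by (auto simp: open_box_def)
  then show ?thesis
    using open_surjective_linear_image[OF open_box] orthogonal_transformation_linear
      orthogonal_transformation_surj by metis
qed (auto simp: open_simplex_def)

text \<open>A convex set with nonempty interior has its frontier as relative frontier, and the
  relative frontier of a polyhedron is made of its facets.\<close>

lemma polyhedral_frontier: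
  assumes "convex_polyhedral_domain \<Omega>"
  shows "frontier \<Omega> = \<Union>{F. F facet_of closure \<Omega>}" "finite {F. F facet_of closure \<Omega>}"
proof -
  have \<Omega>: "open \<Omega>" "\<Omega> \<noteq> {}" "convex \<Omega>" "polyhedron (closure \<Omega>)"
    using assms by (auto simp: convex_polyhedral_domain_def)
  have "interior (closure \<Omega>) = \<Omega>"
    using \<Omega> by (simp add: convex_interior_closure interior_open)
  then have "rel_frontier (closure \<Omega>) = frontier \<Omega>"
    using \<Omega> by (simp add: rel_frontier_nonempty_interior) (simp add: frontier_def interior_open)
  then show "frontier \<Omega> = \<Union>{F. F facet_of closure \<Omega>}"
    using rel_frontier_of_polyhedron[OF \<Omega>(4)] by simp
  show "finite {F. F facet_of closure \<Omega>}"
    using \<Omega>(4) by (rule finite_polyhedron_facets)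
qed

text \<open>Both functions are affine on the polytope, so its finitely many vertices decide.\<close>

lemma affine_perturbation_nonpos_on_polytope:
  fixes v w :: "'a::euclidean_space \<Rightarrow> real"
  assumes P: "polytope P" and v: "\<And>x. x \<in> P \<Longrightarrow> v x = a \<bullet> x + b" and w: "\<And>x. x \<in> P \<Longrightarrow> w x = c \<bullet> x + d"
    and nonpos: "\<And>x. x \<in> P \<Longrightarrow> v x \<le> 0" "\<And>x. x \<in> P \<Longrightarrow> v x = 0 \<Longrightarrow> w x \<le> 0"
  obtains e where "e > 0" "\<And>x t. x \<in> P \<Longrightarrow> 0 \<le> t \<Longrightarrow> t \<le> e \<Longrightarrow> v x + t * w x \<le> 0"
proof -
  obtain X where X: "finite X" "P = convex hull X"
    using P by (auto simp: polytope_def)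
  have XP: "X \<subseteq> P"
    by (simp add: X hull_subset)
  have "\<exists>e>0. \<forall>t. 0 \<le> t \<and> t \<le> e \<longrightarrow> v x + t * w x \<le> 0" if "x \<in> X" for x
  proof (cases "v x = 0")
    case True
    then have "w x \<le> 0" using nonpos(2) that XP by blast
    then show ?thesis using True by (intro exI[of _ 1]) (auto simp: mult_nonneg_nonpos)
  next
    case False
    then have neg: "v x < 0" using nonpos(1)[of x] that XP by force
    \<comment> \<open>Solves \<open>v x + e * (\<bar>w x\<bar> + 1) = 0\<close>; the added 1 keeps
      the denominator positive when \<open>w x = 0\<close>.\<close>
    define e where "e = - v x / (\<bar>w x\<bar> + 1)"
    have "e > 0" using divide_neg_pos[OF neg, of "\<bar>w x\<bar> + 1"] by (simp add: e_def)
    moreover have "v x + t * w x \<le> 0" if "0 \<le> t" "t \<le> e" for t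
    proof -
      have "t * w x \<le> t * (\<bar>w x\<bar> + 1)"
        using that by (intro mult_left_mono) auto
      also have "\<dots> \<le> e * (\<bar>w x\<bar> + 1)"
        using that by (intro mult_right_mono) auto
      also have "\<dots> = - v x" by (simp add: e_def)
      finally show ?thesis by simp
    qed
    ultimately show ?thesis by blast
  qed
  then obtain E where E: "\<And>x. x \<in> X \<Longrightarrow> E x > 0"
    "\<And>x t. x \<in> X \<Longrightarrow> 0 \<le> t \<Longrightarrow> t \<le> E x \<Longrightarrow> v x + t * w x \<le> 0"
    by metis
  \<comment> \<open>The inserted 1 keeps the minimum meaningful for an empty polytope.\<close>
  define e where "e = Min (insert 1 (E ` X))"
  have "e > 0" using X(1) E(1) by (simp add: e_def)
  moreover have "v x + t * w x \<le> 0" if x: "x \<in> P" and t: "0 \<le> t" "t \<le> e" for x t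
  proof -
    \<comment> \<open>For fixed \<open>t\<close> the perturbed function is affine, so nonpositivity
      describes a half-space; being convex, it contains the hull of the vertices.\<close>
    have "X \<subseteq> {y. (a + t *\<^sub>R c) \<bullet> y \<le> - (b + t * d)}"
    proof
      fix y assume y: "y \<in> X"
      then have "e \<le> E y" using X(1) by (simp add: e_def)
      then have "v y + t * w y \<le> 0" using E(2)[OF y] t by simp
      moreover have "y \<in> P" using y XP by blast
      ultimately show "y \<in> {y. (a + t *\<^sub>R c) \<bullet> y \<le> - (b + t * d)}"
        using v w by (simp add: algebra_simps inner_simps)
    qed
    then have "P \<subseteq> {y. (a + t *\<^sub>R c) \<bullet> y \<le> - (b + t * d)}"
      unfolding X(2) by (rule hull_minimal) (rule convex_halfspace_le)
    then show ?thesis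
      using x v[OF x] w[OF x] by (auto simp: algebra_simps inner_simps)
  qed
  ultimately show thesis using that by blast
qed

lemma affine_on_closure:
  fixes v :: "'a::euclidean_space \<Rightarrow> real"
  assumes "continuous_on (closure K) v" "\<And>x. x \<in> K \<Longrightarrow> v x = a \<bullet> x + b" "x \<in> closure K"
  shows "v x = a \<bullet> x + b"
proof -
  have "continuous_on (closure K) (\<lambda>x. v x - (a \<bullet> x + b))"
    using assms(1) by (intro continuous_intros)
  then have "v x - (a \<bullet> x + b) = 0"
    by (rule continuous_constant_on_closure) (use assms in auto)
  then show ?thesis by simp
qed

text \<open>Alignment leaves two cases. Either the cell meets the whole boundary of
  \<open>\<Omega>\<close> inside \<open>\<Gamma>\<close>, and the facets of \<open>\<Omega>\<close>
  cut this contact into polytopes; or the cell meets \<open>\<Gamma>\<close> in nothing, a point or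
  an edge, which is itself a polytope. No regularity of \<open>\<Gamma>\<close> beyond this
  enters.\<close>

lemma aligned_boundary_polytopes:
  fixes \<Omega> :: "'a::euclidean_space set"
  assumes \<Omega>: "convex_polyhedral_domain \<Omega>" and mesh: "conforming_mesh \<Omega> T" "aligned_mesh \<Omega> T \<Gamma>"
    and \<Gamma>: "\<Gamma> \<subseteq> frontier \<Omega>" and K: "K \<in> T"
  obtains Q where "finite Q" "closure K \<inter> \<Gamma> = \<Union>Q" "\<And>P. P \<in> Q \<Longrightarrow> polytope P"
proof -
  have cell: "open_simplex K \<or> open_box K" and "K \<subseteq> \<Omega>"
    using mesh(1) K by (auto simp: conforming_mesh_def)
  have poly: "polytope (closure K)"
    using cell by (rule polytope_closure_cell)
  have open\<Omega>: "open \<Omega>"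
    using \<Omega> by (simp add: convex_polyhedral_domain_def)
  \<comment> \<open>The cell lies in the open set \<open>\<Omega>\<close> and so misses its
    frontier: only the frontier of the cell can meet it.\<close>
  have fr: "frontier K \<inter> frontier \<Omega> = closure K \<inter> frontier \<Omega>"
    using open_cell[OF cell] open\<Omega> \<open>K \<subseteq> \<Omega>\<close> by (auto simp: frontier_def interior_open)
  then have eq: "frontier K \<inter> frontier \<Omega> \<inter> \<Gamma> = closure K \<inter> \<Gamma>"
    using \<Gamma> by auto
  have "closure K \<inter> frontier \<Omega> \<subseteq> \<Gamma> \<or> closure K \<inter> \<Gamma> = {} \<or>
      (\<exists>x. closure K \<inter> \<Gamma> = {x}) \<or> (closure K \<inter> \<Gamma>) face_of closure K"
    using mesh(2)[unfolded aligned_mesh_def, rule_format, OF K]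
    unfolding eq by (simp only: fr edge_of_def) (elim disjE conjE; simp)
  then have "closure K \<inter> frontier \<Omega> \<subseteq> \<Gamma> \<or> polytope (closure K \<inter> \<Gamma>)"
    using face_of_polytope_polytope[OF poly] by (elim disjE exE) (simp_all add: polytope_empty polytope_sing)
  then consider "closure K \<inter> frontier \<Omega> \<subseteq> \<Gamma>" | "polytope (closure K \<inter> \<Gamma>)"
    by linarith
  then show thesis
  proof cases
    case 1
    let ?Q = "(\<lambda>F. closure K \<inter> F) ` {F. F facet_of closure \<Omega>}"
    have "closure K \<inter> \<Gamma> = closure K \<inter> frontier \<Omega>"
      using 1 \<Gamma> by (intro equalityI subsetI IntI; simp add: subset_iff)
    also have "\<dots> = \<Union>?Q"
      by (subst polyhedral_frontier(1)[OF \<Omega>]) (simp only: Int_Union image_def)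
    finally have "closure K \<inter> \<Gamma> = \<Union>?Q" .
    moreover have "polytope (closure K \<inter> F)" if "F facet_of closure \<Omega>" for F
      using that poly facet_of_imp_face_of face_of_polyhedron_polyhedron polytope_Int_polyhedron \<Omega>
      unfolding convex_polyhedral_domain_def by blast
    ultimately show thesis
      using polyhedral_frontier(2)[OF \<Omega>] by (intro that[of ?Q]) auto
  next
    case 2
    then show thesis by (intro that[of "{closure K \<inter> \<Gamma>}"]) auto
  qed
qed

text \<open>Each cell meets \<open>\<Gamma>\<close> in finitely many polytopes and there are
  finitely many cells, so the smallest of their step lengths is positive and serves
  everywhere.\<close>

lemma fe_perturbation_nonpos:
  fixes \<Omega> :: "'a::euclidean_space set"
  assumes \<Omega>: "convex_polyhedral_domain \<Omega>" and mesh: "conforming_mesh \<Omega> T" "aligned_mesh \<Omega> T \<Gamma>"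
    and \<Gamma>: "\<Gamma> \<subseteq> frontier \<Omega>"
    and v: "continuous_on (closure \<Omega>) v" "\<forall>K\<in>T. \<exists>a b. \<forall>x\<in>K. v x = a \<bullet> x + b"
    and w: "continuous_on (closure \<Omega>) w" "\<forall>K\<in>T. \<exists>a b. \<forall>x\<in>K. w x = a \<bullet> x + b"
    and nonpos: "\<And>x. x \<in> \<Gamma> \<Longrightarrow> v x \<le> 0" "\<And>x. x \<in> \<Gamma> \<Longrightarrow> v x = 0 \<Longrightarrow> w x \<le> 0"
  obtains e where "e > 0" "\<And>x. x \<in> \<Gamma> \<Longrightarrow> v x + e * w x \<le> 0"
proof -
  \<comment> \<open>Claimed for all \<open>t\<close> up to \<open>e\<close> and not just for
    \<open>e\<close>, so that step lengths may be shrunk when minima are taken.\<close>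
  have "\<exists>e>0. \<forall>x\<in>closure K \<inter> \<Gamma>. \<forall>t. 0 \<le> t \<and> t \<le> e \<longrightarrow> v x + t * w x \<le> 0" if K: "K \<in> T" for K
  proof -
    have "closure K \<subseteq> closure \<Omega>"
      using mesh(1) K by (auto simp: conforming_mesh_def intro!: closure_mono)
    then have cont: "continuous_on (closure K) v" "continuous_on (closure K) w"
      using v(1) w(1) continuous_on_subset by blast+
    obtain a b c d where "\<forall>x\<in>K. v x = a \<bullet> x + b" "\<forall>x\<in>K. w x = c \<bullet> x + d"
      using v(2) w(2) K by metis
    then have aff: "v x = a \<bullet> x + b" "w x = c \<bullet> x + d" if "x \<in> closure K" for x
      using affine_on_closure[OF cont(1) _ that] affine_on_closure[OF cont(2) _ that] by auto
    obtain Q where Q: "finite Q" "closure K \<inter> \<Gamma> = \<Union>Q" "\<And>P. P \<in> Q \<Longrightarrow> polytope P"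
      using aligned_boundary_polytopes[OF \<Omega> mesh \<Gamma> K] by blast
    have "\<exists>e>0. \<forall>x\<in>P. \<forall>t. 0 \<le> t \<and> t \<le> e \<longrightarrow> v x + t * w x \<le> 0" if P: "P \<in> Q" for P
    proof -
      have sub: "P \<subseteq> closure K \<inter> \<Gamma>" using P Q(2) by blast
      have "v x = a \<bullet> x + b" "w x = c \<bullet> x + d" "v x \<le> 0" "v x = 0 \<Longrightarrow> w x \<le> 0" if "x \<in> P" for x
        using that sub aff nonpos by blast+
      from affine_perturbation_nonpos_on_polytope[OF Q(3)[OF P] this] show ?thesis
        by metis
    qed
    then obtain E where E: "\<And>P. P \<in> Q \<Longrightarrow> E P > 0"
      "\<And>P x t. P \<in> Q \<Longrightarrow> x \<in> P \<Longrightarrow> 0 \<le> t \<Longrightarrow> t \<le> E P \<Longrightarrow> v x + t * w x \<le> 0"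
      by metis
    have "Min (insert 1 (E ` Q)) > 0" using Q(1) E(1) by simp
    moreover have "Min (insert 1 (E ` Q)) \<le> E P" if "P \<in> Q" for P
      using Q(1) that by simp
    ultimately show ?thesis
      using E(2) unfolding Q(2) by (intro exI[of _ "Min (insert 1 (E ` Q))"]) (meson UnionE order_trans)
  qed
  then obtain E where E: "\<And>K. K \<in> T \<Longrightarrow> E K > 0"
    "\<And>K x t. K \<in> T \<Longrightarrow> x \<in> closure K \<inter> \<Gamma> \<Longrightarrow> 0 \<le> t \<Longrightarrow> t \<le> E K \<Longrightarrow> v x + t * w x \<le> 0"
    by metis
  have T: "finite T" "(\<Union>K\<in>T. closure K) = closure \<Omega>"
    using mesh(1) by (auto simp: conforming_mesh_def)
  define e where "e = Min (insert 1 (E ` T))"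
  have "e > 0" using T(1) E(1) by (simp add: e_def)
  moreover have "v x + e * w x \<le> 0" if x: "x \<in> \<Gamma>" for x
  proof -
    obtain K where K: "K \<in> T" "x \<in> closure K"
      using T(2) \<Gamma> x by (auto simp: frontier_def)
    moreover have "e \<le> E K" using K T(1) by (simp add: e_def)
    ultimately show ?thesis using E(2)[of K x e] x \<open>e > 0\<close> by simp
  qed
  ultimately show thesis using that by blast
qed

subsection \<open>The error estimate\<close>

text \<open>Completeness of Lebesgue measure. It provides measurability of the neglected integrand,
  in which \<open>k\<close> is an arbitrary function.\<close>

lemma borel_measurable_lebesgue_on_cong_AE:
  fixes f g :: "'a::euclidean_space \<Rightarrow> real"
  assumes S: "S \<in> sets lebesgue" and f: "f \<in> borel_measurable (lebesgue_on S)"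
    and eq: "AE x in lebesgue_on S. f x = g x"
  shows "g \<in> borel_measurable (lebesgue_on S)"
proof -
  define F G where "F x = (if x \<in> S then f x else 0)" and "G x = (if x \<in> S then g x else 0)" for x
  have F: "F \<in> borel_measurable lebesgue"
    unfolding F_def using S f by (simp add: borel_measurable_if)
  have FG: "AE x in lebesgue. F x = G x"
    using eq S by (simp add: AE_restrict_space_iff F_def G_def)
  have "G \<in> borel_measurable lebesgue"
  proof (rule measurableI)
    fix B :: "real set" assume "B \<in> sets borel"
    then have "F -` B \<in> sets lebesgue"
      using measurable_sets[OF F] by simp
    moreover have "AE x in lebesgue. x \<in> F -` B \<longleftrightarrow> x \<in> G -` B"
      using FG by eventually_elim simp
    ultimately show "G -` B \<inter> space lebesgue \<in> sets lebesgue"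
      using completion.in_sets_AE[of "F -` B" "G -` B" lborel] by simp
  qed simp
  then show ?thesis
    using S unfolding G_def by (simp add: borel_measurable_if)
qed

lemma L2_inner_minus_left: "L2_inner M (\<lambda>x. - F x) G = - L2_inner M F G"
  by (simp add: L2_inner_def)

lemma L2_inner_diff_left:
  "F \<in> L2_space M \<Longrightarrow> F' \<in> L2_space M \<Longrightarrow> G \<in> L2_space M \<Longrightarrow>
    L2_inner M (\<lambda>x. F x - F' x) G = L2_inner M F G - L2_inner M F' G"
  by (simp add: L2_inner_def inner_diff_left L2_space_inner_integrable)

lemma L2_inner_weak_grad_lincomb:
  fixes \<Omega> :: "'a::euclidean_space set"
  assumes \<Omega>: "open \<Omega>" "bounded \<Omega>" and F: "F \<in> L2_space (lebesgue_on \<Omega>)"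
    and v: "v \<in> H1 \<Omega>" and w: "w \<in> H1 \<Omega>"
  shows "L2_inner (lebesgue_on \<Omega>) F (weak_grad \<Omega> (\<lambda>x. a * v x + c * w x))
    = a * L2_inner (lebesgue_on \<Omega>) F (weak_grad \<Omega> v) + c * L2_inner (lebesgue_on \<Omega>) F (weak_grad \<Omega> w)"
proof -
  have "L2_inner (lebesgue_on \<Omega>) F (weak_grad \<Omega> (\<lambda>x. a * v x + c * w x))
      = (\<integral>x. a * (F x \<bullet> weak_grad \<Omega> v x) + c * (F x \<bullet> weak_grad \<Omega> w x) \<partial>lebesgue_on \<Omega>)"
    unfolding L2_inner_def
  proof (rule integral_cong_AE)
    show "AE x in lebesgue_on \<Omega>. F x \<bullet> weak_grad \<Omega> (\<lambda>x. a * v x + c * w x) x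
        = a * (F x \<bullet> weak_grad \<Omega> v x) + c * (F x \<bullet> weak_grad \<Omega> w x)"
      using weak_grad_lincomb[OF \<Omega> v w, of a c]
      by eventually_elim (simp add: inner_add_right)
  qed (use L2_space_measurable[OF F] L2_space_measurable[OF weak_grad_H1(1)[OF v]]
      L2_space_measurable[OF weak_grad_H1(1)[OF w]]
      L2_space_measurable[OF weak_grad_H1(1)[OF H1_lincomb(1)[OF \<Omega> v w]]] in auto)
  then show ?thesis
    using L2_space_inner_integrable[OF F weak_grad_H1(1)[OF v]]
      L2_space_inner_integrable[OF F weak_grad_H1(1)[OF w]]
    by (simp add: L2_inner_def)
qed

lemma L2_Cauchy_Schwarz:
  fixes F G :: "'a \<Rightarrow> real"
  assumes F: "F \<in> L2_space M" and G: "G \<in> L2_space M"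
  shows "(\<integral>x. \<bar>F x * G x\<bar> \<partial>M) \<le> L2_norm M F * L2_norm M G"
proof -
  have [measurable]: "F \<in> borel_measurable M" "G \<in> borel_measurable M"
    using F G by (auto simp: L2_space_def)
  have int: "integrable M (\<lambda>x. (F x)\<^sup>2)" "integrable M (\<lambda>x. (G x)\<^sup>2)" "integrable M (\<lambda>x. \<bar>F x * G x\<bar>)"
    using F G L2_space_inner_integrable[OF F G] by (auto simp: L2_space_def intro!: integrable_abs)
  have "(\<integral>\<^sup>+x. ennreal \<bar>F x\<bar> * ennreal \<bar>G x\<bar> \<partial>M)\<^sup>2
      \<le> (\<integral>\<^sup>+x. (ennreal \<bar>F x\<bar>)\<^sup>2 \<partial>M) * (\<integral>\<^sup>+x. (ennreal \<bar>G x\<bar>)\<^sup>2 \<partial>M)"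
    by (rule Cauchy_Schwarz_nn_integral) auto
  also have "(\<integral>\<^sup>+x. ennreal \<bar>F x\<bar> * ennreal \<bar>G x\<bar> \<partial>M) = ennreal (\<integral>x. \<bar>F x * G x\<bar> \<partial>M)"
    using int(3) by (simp add: nn_integral_eq_integral abs_mult flip: ennreal_mult)
  also have "(\<integral>\<^sup>+x. (ennreal \<bar>F x\<bar>)\<^sup>2 \<partial>M) = ennreal (\<integral>x. (F x)\<^sup>2 \<partial>M)"
    using int(1) by (simp add: nn_integral_eq_integral ennreal_power)
  also have "(\<integral>\<^sup>+x. (ennreal \<bar>G x\<bar>)\<^sup>2 \<partial>M) = ennreal (\<integral>x. (G x)\<^sup>2 \<partial>M)"
    using int(2) by (simp add: nn_integral_eq_integral ennreal_power)
  finally have "(\<integral>x. \<bar>F x * G x\<bar> \<partial>M)\<^sup>2 \<le> (\<integral>x. (F x)\<^sup>2 \<partial>M) * (\<integral>x. (G x)\<^sup>2 \<partial>M)"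
    by (simp add: ennreal_power flip: ennreal_mult)
  then show ?thesis
    unfolding L2_norm_def real_sqrt_mult[symmetric] by (simp add: real_le_rsqrt)
qed

section \<open>Linearisation of the error and size of the neglected term\<close>

lemma height_affine: "height p c = (\<lambda>x. p \<bullet> x + - c)"
  by (auto simp: height_def)

lemma height_in_H1: "open \<Omega> \<Longrightarrow> bounded \<Omega> \<Longrightarrow> height p c \<in> H1 \<Omega>"
  unfolding height_affine by (rule affine_in_H1)

text \<open>Let a and b be the gradients of \<open>u + hz\<close> and \<open>uh + hz\<close>. The
  height cancels in a - b, and almost everywhere k(u) a - k(uh) b = k(u) (a - b) + (k(u) - k(uh))
  b.\<close>

lemma linearised_error_decomposition:
  fixes \<Omega> :: "'a::euclidean_space set"
  assumes \<Omega>: "open \<Omega>" "bounded \<Omega>" and H1: "u \<in> H1 \<Omega>" "uh \<in> H1 \<Omega>" "hz \<in> H1 \<Omega>" "z \<in> H1 \<Omega>"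
    and flux: "flux \<Omega> k hz u \<in> L2_space (lebesgue_on \<Omega>)" "flux \<Omega> k hz uh \<in> L2_space (lebesgue_on \<Omega>)"
    and int: "integrable (lebesgue_on \<Omega>)
      (\<lambda>x. (k (u x) *\<^sub>R weak_grad \<Omega> (\<lambda>y. u y - uh y) x) \<bullet> weak_grad \<Omega> z x)"
  shows "L2_inner (lebesgue_on \<Omega>) (\<lambda>x. k (u x) *\<^sub>R weak_grad \<Omega> (\<lambda>y. u y - uh y) x) (weak_grad \<Omega> z)
    = principal_term \<Omega> k hz u uh z - neglected_term \<Omega> k hz u uh z"
proof -
  define P where "P x = (flux \<Omega> k hz uh x - flux \<Omega> k hz u x) \<bullet> weak_grad \<Omega> z x" for x
  define E where "E x = (k (u x) *\<^sub>R weak_grad \<Omega> (\<lambda>y. u y - uh y) x) \<bullet> weak_grad \<Omega> z x" for x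
  define N where "N x = ((k (u x) - k (uh x)) *\<^sub>R weak_grad \<Omega> (\<lambda>y. uh y + hz y) x) \<bullet> weak_grad \<Omega> z x" for x
  have plus: "(\<lambda>y. u y + hz y) \<in> H1 \<Omega>" "(\<lambda>y. uh y + hz y) \<in> H1 \<Omega>"
    using H1_lincomb[OF \<Omega> H1(1) H1(3), of 1 1] H1_lincomb[OF \<Omega> H1(2) H1(3), of 1 1] by simp_all
  have "AE x in lebesgue_on \<Omega>. weak_grad \<Omega> (\<lambda>y. u y - uh y) x
      = weak_grad \<Omega> (\<lambda>y. u y + hz y) x - weak_grad \<Omega> (\<lambda>y. uh y + hz y) x"
    using weak_grad_lincomb[OF \<Omega> plus, of 1 "-1"] by simp
  then have eq: "AE x in lebesgue_on \<Omega>. P x - E x = N x"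
    by eventually_elim (simp add: P_def E_def N_def flux_def inner_simps left_diff_distrib right_diff_distrib)
  have "integrable (lebesgue_on \<Omega>) P"
    unfolding P_def inner_diff_left
    using L2_space_inner_integrable[OF flux(1) weak_grad_H1(1)[OF H1(4)]]
      L2_space_inner_integrable[OF flux(2) weak_grad_H1(1)[OF H1(4)]] by simp
  moreover have "integrable (lebesgue_on \<Omega>) E"
    using int by (simp add: E_def[abs_def])
  ultimately have PE: "integrable (lebesgue_on \<Omega>) P" "integrable (lebesgue_on \<Omega>) E" by auto
  then have meas: "(\<lambda>x. P x - E x) \<in> borel_measurable (lebesgue_on \<Omega>)"
    by (auto intro: borel_measurable_integrable)
  \<comment> \<open>Measurability of \<open>N\<close> cannot be read off from its formula; it is
    inherited from \<open>P - E\<close>, whose terms are integrable by the assumptions on the fluxes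
    and on the dual form.\<close>
  then have "N \<in> borel_measurable (lebesgue_on \<Omega>)"
    using \<Omega> by (intro borel_measurable_lebesgue_on_cong_AE[OF _ meas eq]) simp
  then have "(\<integral>x. N x \<partial>lebesgue_on \<Omega>) = (\<integral>x. P x - E x \<partial>lebesgue_on \<Omega>)"
    using meas eq by (intro integral_cong_AE) auto
  also have "\<dots> = (\<integral>x. P x \<partial>lebesgue_on \<Omega>) - (\<integral>x. E x \<partial>lebesgue_on \<Omega>)"
    using PE by simp
  finally show ?thesis
    by (simp add: principal_term_def neglected_term_def L2_inner_def P_def E_def N_def)
qed

text \<open>Lipschitz continuity replaces the difference of conductivities by the error itself.
  Keeping the product of the two gradients together as one L^2 function lets Cauchy-Schwarz split
  off exactly the L^2 norm of the error, to which the convergence assumption applies.\<close>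

lemma neglected_term_bound:
  fixes \<Omega> :: "'a::euclidean_space set"
  assumes k: "L-lipschitz_on UNIV k"
    and w: "(\<lambda>x. u x - uh x) \<in> L2_space (lebesgue_on \<Omega>)"
    and G: "(\<lambda>x. weak_grad \<Omega> (\<lambda>y. uh y + hz y) x \<bullet> weak_grad \<Omega> z x) \<in> L2_space (lebesgue_on \<Omega>)"
  shows "\<bar>neglected_term \<Omega> k hz u uh z\<bar>
    \<le> L * L2_norm (lebesgue_on \<Omega>) (\<lambda>x. u x - uh x)
        * L2_norm (lebesgue_on \<Omega>) (\<lambda>x. weak_grad \<Omega> (\<lambda>y. uh y + hz y) x \<bullet> weak_grad \<Omega> z x)"
proof -
  let ?G = "\<lambda>x. weak_grad \<Omega> (\<lambda>y. uh y + hz y) x \<bullet> weak_grad \<Omega> z x"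
  have L: "0 \<le> L" "\<bar>k s - k t\<bar> \<le> L * \<bar>s - t\<bar>" for s t
    using k by (auto simp: lipschitz_on_def dist_real_def)
  have int: "integrable (lebesgue_on \<Omega>) (\<lambda>x. \<bar>(u x - uh x) * ?G x\<bar>)"
    using L2_space_inner_integrable[OF w G] by (auto intro: integrable_abs)
  have "\<bar>neglected_term \<Omega> k hz u uh z\<bar> \<le> (\<integral>x. \<bar>(k (u x) - k (uh x)) * ?G x\<bar> \<partial>lebesgue_on \<Omega>)"
    unfolding neglected_term_def L2_inner_def by (simp add: integral_abs_bound)
  also have "\<dots> \<le> (\<integral>x. L * \<bar>(u x - uh x) * ?G x\<bar> \<partial>lebesgue_on \<Omega>)"
  proof (rule integral_mono')
    show "\<bar>(k (u x) - k (uh x)) * ?G x\<bar> \<le> L * \<bar>(u x - uh x) * ?G x\<bar>" for x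
      using mult_right_mono[OF L(2)[of "u x" "uh x"], of "\<bar>?G x\<bar>"] by (simp add: abs_mult mult.assoc)
  qed (use int L in auto)
  also have "\<dots> = L * (\<integral>x. \<bar>(u x - uh x) * ?G x\<bar> \<partial>lebesgue_on \<Omega>)"
    by simp
  also have "\<dots> \<le> L * (L2_norm (lebesgue_on \<Omega>) (\<lambda>x. u x - uh x) * L2_norm (lebesgue_on \<Omega>) ?G)"
    using L(1) L2_Cauchy_Schwarz[OF w G] by (intro mult_left_mono)
  finally show ?thesis by (simp add: mult.assoc)
qed

section \<open>Discrete variational inequality in directions controlled on the contact set\<close>

lemma Vh_space_lincomb:
  fixes \<Omega> :: "'a::euclidean_space set"
  assumes \<Omega>: "open \<Omega>" "bounded \<Omega>" and v: "v \<in> Vh_space \<Omega> \<Gamma>D T \<gamma>" and w: "w \<in> Vh_space \<Omega> \<Gamma>D T \<delta>"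
  shows "(\<lambda>x. a * v x + c * w x) \<in> Vh_space \<Omega> \<Gamma>D T (\<lambda>x. a * \<gamma> x + c * \<delta> x)"
proof -
  have H: "(\<lambda>x. a * v x + c * w x) \<in> H1 \<Omega>"
    using v w by (intro H1_lincomb \<Omega>) (auto simp: Vh_space_def V_space_def)
  have cont: "continuous_on (closure \<Omega>) (\<lambda>x. a * v x + c * w x)"
    using v w by (intro continuous_intros) (auto simp: Vh_space_def)
  have "\<exists>p q. \<forall>x\<in>K. a * v x + c * w x = p \<bullet> x + q" if K: "K \<in> T" for K
  proof -
    have "\<exists>p q. \<forall>x\<in>K. v x = p \<bullet> x + q" "\<exists>p q. \<forall>x\<in>K. w x = p \<bullet> x + q"
      using v w K by (auto simp: Vh_space_def)
    then obtain p q p' q' where "\<forall>x\<in>K. v x = p \<bullet> x + q" "\<forall>x\<in>K. w x = p' \<bullet> x + q'"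
      by auto
    then show ?thesis
      by (intro exI[of _ "a *\<^sub>R p + c *\<^sub>R p'"] exI[of _ "a * q + c * q'"])
        (simp add: algebra_simps inner_simps)
  qed
  then show ?thesis
    using H cont continuous_has_trace[OF H cont] v w
    unfolding Vh_space_def V_space_def
    by (auto intro!: exI[of _ "\<lambda>x. a * v x + c * w x"])
qed

text \<open>
  \<open>uh + e zh\<close> is admissible in the discrete problem for small \<open>e > 0\<close>, although \<open>zh\<close> is
  only controlled on the contact set.
\<close>

lemma discrete_variational_ineq_Wh:
  fixes \<Omega> :: "'a::euclidean_space set"
  assumes \<Omega>: "convex_polyhedral_domain \<Omega>" and mesh: "conforming_mesh \<Omega> T" "aligned_mesh \<Omega> T \<Gamma>A"
    and \<Gamma>A: "\<Gamma>A \<subseteq> frontier \<Omega>" and g: "discrete_extension \<Omega> \<Gamma>A \<Gamma>D T gD g"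
    and uh: "discrete_solution \<Omega> \<Gamma>A \<Gamma>D T k hz f gD g uh"
    and zh: "zh \<in> Wh_space \<Omega> \<Gamma>D T (contact_set \<Gamma>A uh) (\<lambda>_. 0)"
  shows "L2_inner (lebesgue_on \<Omega>) f zh \<le> - L2_inner (lebesgue_on \<Omega>) (flux \<Omega> k hz uh) (weak_grad \<Omega> zh)"
proof -
  have \<Omega>': "open \<Omega>" "bounded \<Omega>"
    using \<Omega> by (auto simp: convex_polyhedral_domain_def)
  have V: "uh \<in> Vh_space \<Omega> \<Gamma>D T gD" "g \<in> Vh_space \<Omega> \<Gamma>D T gD" "zh \<in> Vh_space \<Omega> \<Gamma>D T (\<lambda>_. 0)"
    using uh g zh by (auto simp: discrete_solution_def Kh_space_def discrete_extension_def Wh_space_def)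
  obtain e where e: "e > 0" "\<And>x. x \<in> \<Gamma>A \<Longrightarrow> uh x + e * zh x \<le> 0"
  proof (rule fe_perturbation_nonpos[OF \<Omega> mesh \<Gamma>A, of uh zh])
    show "uh x \<le> 0" if "x \<in> \<Gamma>A" for x
      using uh that by (auto simp: discrete_solution_def Kh_space_def)
    show "zh x \<le> 0" if "x \<in> \<Gamma>A" "uh x = 0" for x
      using zh that by (auto simp: Wh_space_def contact_set_def)
  qed (use V that in \<open>auto simp: Vh_space_def\<close>)
  \<comment> \<open>Subtracting \<open>g\<close> removes the Dirichlet data and leaves the values on
    \<open>\<Gamma>A\<close> unchanged, so \<open>v\<close> is admissible and the direction
    \<open>v + g - uh\<close> is \<open>e * zh\<close>. The explicit factors, and the summand
    \<open>0 * zh x\<close> below, give the shape of a linear combination of two functions.\<close>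
  define v where "v x = 1 * (1 * uh x + (-1) * g x) + e * zh x" for x
  have "v \<in> Vh_space \<Omega> \<Gamma>D T (\<lambda>x. 1 * (1 * gD x + (-1) * gD x) + e * 0)"
    unfolding v_def[abs_def] by (intro Vh_space_lincomb \<Omega>' V)
  then have "v \<in> Kh_space \<Omega> \<Gamma>A \<Gamma>D T (\<lambda>_. 0)"
    using e(2) g by (auto simp: Kh_space_def discrete_extension_def v_def)
  then have "L2_inner (lebesgue_on \<Omega>) f (\<lambda>x. v x + g x - uh x)
      \<le> L2_inner (lebesgue_on \<Omega>) (\<lambda>x. - flux \<Omega> k hz uh x) (weak_grad \<Omega> (\<lambda>x. v x + g x - uh x))"
    using uh by (simp add: discrete_solution_def variational_ineq_def)
  moreover have "(\<lambda>x. v x + g x - uh x) = (\<lambda>x. e * zh x + 0 * zh x)"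
    by (simp add: v_def)
  moreover have H: "zh \<in> H1 \<Omega>"
    using V(3) by (simp add: Vh_space_def V_space_def)
  have q: "flux \<Omega> k hz uh \<in> L2_space (lebesgue_on \<Omega>)"
    using uh by (simp add: discrete_solution_def)
  ultimately have "L2_inner (lebesgue_on \<Omega>) f (\<lambda>x. e * zh x + 0 * zh x)
      \<le> - (e * L2_inner (lebesgue_on \<Omega>) (flux \<Omega> k hz uh) (weak_grad \<Omega> zh)
        + 0 * L2_inner (lebesgue_on \<Omega>) (flux \<Omega> k hz uh) (weak_grad \<Omega> zh))"
    by (simp only: L2_inner_minus_left L2_inner_weak_grad_lincomb[OF \<Omega>' q H H])
  moreover have "L2_inner (lebesgue_on \<Omega>) f (\<lambda>x. e * zh x + 0 * zh x) = e * L2_inner (lebesgue_on \<Omega>) f zh"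
    by (simp add: L2_inner_def mult.left_commute)
  ultimately have "e * L2_inner (lebesgue_on \<Omega>) f zh
      \<le> e * - L2_inner (lebesgue_on \<Omega>) (flux \<Omega> k hz uh) (weak_grad \<Omega> zh)"
    by simp
  then show ?thesis
    using e(1) by (rule mult_left_le_imp_le)
qed

section \<open>Boundary integrals and admissibility in the dual problem\<close>

lemma boundary_part_in_surface_sets:
  assumes "\<Gamma> \<in> sets borel" "\<Gamma> \<subseteq> frontier \<Omega>"
  shows "\<Gamma> \<in> sets (surface_measure \<Omega>)"
proof -
  have "sets (hausdorff_measure (DIM('a) - 1) :: 'a measure) = sets borel"
    unfolding hausdorff_measure_def by (metis sets.sets_measure_of_eq space_borel)
  moreover have "\<Gamma> = frontier \<Omega> \<inter> \<Gamma>" using assms(2) by blast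
  ultimately show ?thesis
    using assms(1) unfolding surface_measure_def sets_restrict_space by (metis image_eqI)
qed

text \<open>Green's formula gives an integral over the whole boundary; \<open>qn\<close> vanishes on
  \<open>\<Gamma>N\<close> and \<open>t\<close> on \<open>\<Gamma>D\<close>, which leaves
  \<open>\<Gamma>A\<close>.\<close>

lemma normal_flux_pairing:
  fixes \<Omega> :: "'a::euclidean_space set"
  assumes parts: "boundary_parts \<Omega> \<Gamma>A \<Gamma>N \<Gamma>D" and u: "seepage_solution \<Omega> \<Gamma>A \<Gamma>N \<Gamma>D k hz f gD u qn"
    and v: "v \<in> H1 \<Omega>" "has_trace \<Omega> v t" "AE x in surface_measure \<Omega>. x \<in> \<Gamma>D \<longrightarrow> t x = 0"
  shows "L2_inner (lebesgue_on \<Omega>) (flux \<Omega> k hz u) (weak_grad \<Omega> v) + L2_inner (lebesgue_on \<Omega>) f v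
    = (LINT x:\<Gamma>A|surface_measure \<Omega>. qn x * t x)"
proof -
  have \<Gamma>A: "\<Gamma>A \<in> sets (surface_measure \<Omega>)"
    using parts by (intro boundary_part_in_surface_sets) (auto simp: boundary_parts_def)
  have tr: "integrable (surface_measure \<Omega>) (\<lambda>x. qn x * t x)"
    "(\<integral>x. qn x * t x \<partial>surface_measure \<Omega>)
      = L2_inner (lebesgue_on \<Omega>) (flux \<Omega> k hz u) (weak_grad \<Omega> v) + L2_inner (lebesgue_on \<Omega>) f v"
    using u v by (auto simp: seepage_solution_def has_normal_trace_def)
  have "AE x in surface_measure \<Omega>. x \<in> \<Gamma>N \<longrightarrow> qn x = 0"
    "AE x in surface_measure \<Omega>. x \<in> \<Gamma>A \<union> \<Gamma>N \<union> \<Gamma>D"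
    using u parts by (auto simp: seepage_solution_def boundary_parts_def)
  with v(3) have "AE x in surface_measure \<Omega>. indicator \<Gamma>A x *\<^sub>R (qn x * t x) = qn x * t x"
    by eventually_elim (auto simp: indicator_def)
  then have "(LINT x:\<Gamma>A|surface_measure \<Omega>. qn x * t x) = (\<integral>x. qn x * t x \<partial>surface_measure \<Omega>)"
    unfolding set_lebesgue_integral_def
    by (intro integral_cong_AE)
      (auto intro!: borel_measurable_integrable integrable_mult_indicator[OF \<Gamma>A tr(1), simplified] tr)
  with tr(2) show ?thesis by simp
qed

text \<open>This sign serves twice: for the boundary term by which the estimate exceeds the
  principal term, and for the integral constraint on the competitor in the dual problem.\<close>

lemma contact_pairing:
  fixes \<Omega> :: "'a::euclidean_space set"
  assumes parts: "boundary_parts \<Omega> \<Gamma>A \<Gamma>N \<Gamma>D" and u: "seepage_solution \<Omega> \<Gamma>A \<Gamma>N \<Gamma>D k hz f gD u qn"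
    and w: "w \<in> H1 \<Omega>" "continuous_on (closure \<Omega>) w" "\<And>x. x \<in> \<Gamma>A \<Longrightarrow> w x \<le> 0"
    and v: "v \<in> H1 \<Omega>" "has_trace \<Omega> v t"
      "(LINT x:\<Gamma>A|surface_measure \<Omega>. - qn x * (t x + w x)) \<le> 0"
  shows "0 \<le> (LINT x:\<Gamma>A|surface_measure \<Omega>. qn x * t x)"
proof -
  have \<Gamma>A: "\<Gamma>A \<in> sets (surface_measure \<Omega>)"
    using parts by (intro boundary_part_in_surface_sets) (auto simp: boundary_parts_def)
  have int: "set_integrable (surface_measure \<Omega>) \<Gamma>A (\<lambda>x. qn x * s x)" if "y \<in> H1 \<Omega>" "has_trace \<Omega> y s" for y s
    unfolding set_integrable_def
    using u that by (intro integrable_mult_indicator \<Gamma>A) (auto simp: seepage_solution_def has_normal_trace_def)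
  note ints = int[OF v(1,2)] int[OF w(1) continuous_has_trace[OF w(1,2)]]
  have "(LINT x:\<Gamma>A|surface_measure \<Omega>. - qn x * (t x + w x))
      = (LINT x:\<Gamma>A|surface_measure \<Omega>. - (qn x * t x + qn x * w x))"
    by (simp add: algebra_simps)
  also have "\<dots> = - ((LINT x:\<Gamma>A|surface_measure \<Omega>. qn x * t x) + (LINT x:\<Gamma>A|surface_measure \<Omega>. qn x * w x))"
    by (subst set_integral_uminus) (simp_all add: set_integral_add ints)
  finally have "- (LINT x:\<Gamma>A|surface_measure \<Omega>. qn x * w x) \<le> (LINT x:\<Gamma>A|surface_measure \<Omega>. qn x * t x)"
    using v(3) by simp
  moreover have "0 \<le> (LINT x:\<Gamma>A|surface_measure \<Omega>. - (qn x * w x))"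
  proof -
    have "AE x in surface_measure \<Omega>. x \<in> \<Gamma>A \<longrightarrow> 0 \<le> qn x"
      using u unfolding seepage_solution_def by (auto elim: AE_mp)
    then have "AE x in surface_measure \<Omega>. 0 \<le> indicator \<Gamma>A x *\<^sub>R (- (qn x * w x))"
      by eventually_elim (auto simp: indicator_def mult_nonneg_nonpos w(3))
    then show ?thesis
      unfolding set_lebesgue_integral_def by (rule integral_nonneg_AE)
  qed
  ultimately show ?thesis
    using ints by (simp add: set_integral_uminus)
qed

text \<open>The \<open>uh\<close> in the integral constraint cancels the \<open>- uh\<close> of the
  competitor, and complementarity removes the trace \<open>s\<close> of \<open>u\<close>. What
  remains is minus the integral of \<open>qn x * t x\<close> over \<open>\<Gamma>A\<close>, with
  \<open>t\<close> the trace of \<open>z\<close>, and \<open>contact_pairing\<close> gives its sign.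
  On \<open>\<Gamma>D\<close> the data of \<open>u\<close> and \<open>uh\<close> cancel.\<close>

lemma dual_competitor:
  fixes \<Omega> :: "'a::euclidean_space set"
  assumes \<Omega>: "open \<Omega>" "bounded \<Omega>" and parts: "boundary_parts \<Omega> \<Gamma>A \<Gamma>N \<Gamma>D"
    and u: "seepage_solution \<Omega> \<Gamma>A \<Gamma>N \<Gamma>D k hz f gD u qn"
    and uh: "uh \<in> Kh_space \<Omega> \<Gamma>A \<Gamma>D T gD" and z: "z \<in> G_space \<Omega> \<Gamma>A \<Gamma>D qn uh"
  shows "(\<lambda>x. z x + (u x - uh x)) \<in> G_space \<Omega> \<Gamma>A \<Gamma>D qn uh"
proof -
  have uh': "uh \<in> H1 \<Omega>" "continuous_on (closure \<Omega>) uh" "\<And>x. x \<in> \<Gamma>A \<Longrightarrow> uh x \<le> 0" "\<And>x. x \<in> \<Gamma>D \<Longrightarrow> uh x = gD x"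
    using uh by (auto simp: Kh_space_def Vh_space_def V_space_def)
  have u': "u \<in> H1 \<Omega>"
    using u by (simp add: seepage_solution_def K_space_def)
  obtain s where s: "has_trace \<Omega> u s" "AE x in surface_measure \<Omega>. x \<in> \<Gamma>D \<longrightarrow> s x = gD x"
    "AE x in surface_measure \<Omega>. x \<in> \<Gamma>A \<longrightarrow> s x \<le> 0 \<and> qn x \<ge> 0 \<and> s x * qn x = 0"
    using u by (auto simp: seepage_solution_def)
  obtain t where z': "z \<in> H1 \<Omega>" and t: "has_trace \<Omega> z t" "AE x in surface_measure \<Omega>. x \<in> \<Gamma>D \<longrightarrow> t x = 0"
    "AE x in surface_measure \<Omega>. x \<in> contact_set \<Gamma>A uh \<longrightarrow> t x \<le> 0"
    "(LINT x:\<Gamma>A|surface_measure \<Omega>. - qn x * (t x + uh x)) \<le> 0"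
    using z by (auto simp: G_space_def)
  have \<Gamma>A: "\<Gamma>A \<in> sets (surface_measure \<Omega>)"
    using parts by (intro boundary_part_in_surface_sets) (auto simp: boundary_parts_def)
  have d: "(\<lambda>x. u x - uh x) \<in> H1 \<Omega>" "has_trace \<Omega> (\<lambda>x. u x - uh x) (\<lambda>x. s x - uh x)"
    using H1_lincomb(1)[OF \<Omega> u' uh'(1), of 1 "-1"]
      has_trace_lincomb[OF \<Omega> u' s(1) uh'(1) continuous_has_trace[OF uh'(1,2)], of 1 "-1"] by simp_all
  have p: "(\<lambda>x. z x + (u x - uh x)) \<in> H1 \<Omega>"
    "has_trace \<Omega> (\<lambda>x. z x + (u x - uh x)) (\<lambda>x. t x + (s x - uh x))"
    using H1_lincomb(1)[OF \<Omega> z' d(1), of 1 1] has_trace_lincomb[OF \<Omega> z' t(1) d, of 1 1] by simp_all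
  have int: "integrable (surface_measure \<Omega>) (\<lambda>x. qn x * r x)" if "y \<in> H1 \<Omega>" "has_trace \<Omega> y r" for y r
    using u that by (auto simp: seepage_solution_def has_normal_trace_def)
  have meas: "(\<lambda>x. indicator \<Gamma>A x *\<^sub>R (- qn x * ((t x + (s x - uh x)) + uh x))) \<in> borel_measurable (surface_measure \<Omega>)"
    "(\<lambda>x. indicator \<Gamma>A x *\<^sub>R (- (qn x * t x))) \<in> borel_measurable (surface_measure \<Omega>)"
    using \<Gamma>A int[OF z' t(1)] int[OF u' s(1)]
    by (auto simp: ring_distribs intro!: borel_measurable_times borel_measurable_diff borel_measurable_uminus
        borel_measurable_indicator dest!: borel_measurable_integrable)
  have "(LINT x:\<Gamma>A|surface_measure \<Omega>. - qn x * ((t x + (s x - uh x)) + uh x))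
      = (LINT x:\<Gamma>A|surface_measure \<Omega>. - (qn x * t x))"
    unfolding set_lebesgue_integral_def
  proof (rule integral_cong_AE[OF meas])
    show "AE x in surface_measure \<Omega>. indicator \<Gamma>A x *\<^sub>R (- qn x * ((t x + (s x - uh x)) + uh x))
        = indicator \<Gamma>A x *\<^sub>R (- (qn x * t x))"
      using s(3) by eventually_elim (auto simp: indicator_def algebra_simps)
  qed
  also have "\<dots> = - (LINT x:\<Gamma>A|surface_measure \<Omega>. qn x * t x)"
    by (simp add: set_lebesgue_integral_def)
  also have "\<dots> \<le> 0"
    using contact_pairing[OF parts u uh'(1-3) z' t(1,4)] by simp
  finally have "(LINT x:\<Gamma>A|surface_measure \<Omega>. - qn x * ((t x + (s x - uh x)) + uh x)) \<le> 0" .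
  moreover have "AE x in surface_measure \<Omega>. x \<in> \<Gamma>D \<longrightarrow> t x + (s x - uh x) = 0"
    using s(2) t(2) by eventually_elim (auto simp: uh'(4))
  moreover have "AE x in surface_measure \<Omega>. x \<in> contact_set \<Gamma>A uh \<longrightarrow> t x + (s x - uh x) \<le> 0"
    using s(3) t(3) by eventually_elim (auto simp: contact_set_def)
  ultimately show ?thesis
    using p unfolding G_space_def by blast
qed

section \<open>Assembly of the estimate\<close>

lemma leading_order_le_smallo:
  assumes "r \<in> o[F](p)" "\<And>i. a i \<le> b i - r i"
  shows "leading_order_le F p a b"
  unfolding leading_order_le_def
proof (intro allI impI)
  fix c :: real assume "c > 0"
  then have "\<forall>\<^sub>F i in F. norm (r i) \<le> c * norm (p i)"
    using assms(1) by (auto simp: smallo_def)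
  then show "\<forall>\<^sub>F i in F. a i \<le> b i + c * \<bar>p i\<bar>"
    by eventually_elim (use assms(2) in \<open>smt (verit) real_norm_def\<close>)
qed

lemma error_le_estimate_minus_neglected:
  fixes \<Omega> :: "'a::euclidean_space set"
  assumes \<Omega>: "convex_polyhedral_domain \<Omega>" and parts: "boundary_parts \<Omega> \<Gamma>A \<Gamma>N \<Gamma>D"
    and hz: "hz \<in> H1 \<Omega>"
    and mesh: "conforming_mesh \<Omega> T" "aligned_mesh \<Omega> T \<Gamma>A"
    and g: "discrete_extension \<Omega> \<Gamma>A \<Gamma>D T gD g"
    and u: "seepage_solution \<Omega> \<Gamma>A \<Gamma>N \<Gamma>D k hz f gD u qn"
    and uh: "discrete_solution \<Omega> \<Gamma>A \<Gamma>D T k hz f gD g uh"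
    and U: "unrestricted_solution \<Omega> \<Gamma>D k hz f gD U"
    and z: "dual_solution \<Omega> \<Gamma>A \<Gamma>D k u qn uh J z"
    and zh: "zh \<in> Wh_space \<Omega> \<Gamma>D T (contact_set \<Gamma>A uh) (\<lambda>_. 0)"
  shows "J (\<lambda>x. u x - uh x) \<le>
    L2_inner (lebesgue_on \<Omega>) (\<lambda>x. flux \<Omega> k hz uh x - flux \<Omega> k hz U x) (weak_grad \<Omega> (\<lambda>x. z x - zh x))
      - neglected_term \<Omega> k hz u uh z"
proof -
  let ?I = "L2_inner (lebesgue_on \<Omega>)"
  let ?q = "flux \<Omega> k hz"
  have \<Omega>': "open \<Omega>" "bounded \<Omega>"
    using \<Omega> by (auto simp: convex_polyhedral_domain_def)
  have \<Gamma>A: "\<Gamma>A \<subseteq> frontier \<Omega>"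
    using parts by (auto simp: boundary_parts_def)
  have Kh: "uh \<in> Kh_space \<Omega> \<Gamma>A \<Gamma>D T gD"
    using uh by (simp add: discrete_solution_def)
  then have uh': "uh \<in> H1 \<Omega>" "continuous_on (closure \<Omega>) uh" "\<And>x. x \<in> \<Gamma>A \<Longrightarrow> uh x \<le> 0"
    by (auto simp: Kh_space_def Vh_space_def V_space_def)
  have u': "u \<in> H1 \<Omega>"
    using u by (simp add: seepage_solution_def K_space_def)
  have zG: "z \<in> G_space \<Omega> \<Gamma>A \<Gamma>D qn uh"
    using z by (simp add: dual_solution_def)
  then obtain t where z': "z \<in> H1 \<Omega>" and t: "has_trace \<Omega> z t"
    "AE x in surface_measure \<Omega>. x \<in> \<Gamma>D \<longrightarrow> t x = 0"
    "(LINT x:\<Gamma>A|surface_measure \<Omega>. - qn x * (t x + uh x)) \<le> 0"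
    by (auto simp: G_space_def)
  have zV: "z \<in> V_space \<Omega> \<Gamma>D (\<lambda>_. 0)"
    using z' t by (auto simp: V_space_def)
  have zhV: "zh \<in> V_space \<Omega> \<Gamma>D (\<lambda>_. 0)" and zh': "zh \<in> H1 \<Omega>"
    using zh by (auto simp: Wh_space_def Vh_space_def V_space_def)
  have q: "?q u \<in> L2_space (lebesgue_on \<Omega>)" "?q uh \<in> L2_space (lebesgue_on \<Omega>)" "?q U \<in> L2_space (lebesgue_on \<Omega>)"
    using u uh U by (auto simp: seepage_solution_def discrete_solution_def unrestricted_solution_def)
  have weq: "(\<lambda>y. z y + (u y - uh y) - z y) = (\<lambda>y. u y - uh y)"
    by simp
  \<comment> \<open>Tested with the competitor, the dual problem yields both the bound on
    \<open>J\<close> and the integrability of the linearised integrand that the decomposition asks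
    for.\<close>
  note dual = z[unfolded dual_solution_def, THEN conjunct2, rule_format,
      OF dual_competitor[OF \<Omega>' parts u Kh zG], unfolded weq]
  have "J (\<lambda>x. u x - uh x) \<le> ?I (\<lambda>x. k (u x) *\<^sub>R weak_grad \<Omega> (\<lambda>y. u y - uh y) x) (weak_grad \<Omega> z)"
    and "integrable (lebesgue_on \<Omega>) (\<lambda>x. (k (u x) *\<^sub>R weak_grad \<Omega> (\<lambda>y. u y - uh y) x) \<bullet> weak_grad \<Omega> z x)"
    using dual by auto
  with linearised_error_decomposition[OF \<Omega>' u' uh'(1) hz z' q(1,2)]
  have J: "J (\<lambda>x. u x - uh x) \<le> principal_term \<Omega> k hz u uh z - neglected_term \<Omega> k hz u uh z"
    by simp
  have prin: "principal_term \<Omega> k hz u uh z = ?I (?q uh) (weak_grad \<Omega> z) - ?I (?q u) (weak_grad \<Omega> z)"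
    unfolding principal_term_def by (intro L2_inner_diff_left q weak_grad_H1 z')
  have zzh: "(\<lambda>x. z x - zh x) = (\<lambda>x. 1 * z x + (-1) * zh x)"
    by simp
  have "?I (\<lambda>x. ?q uh x - ?q U x) (weak_grad \<Omega> (\<lambda>x. z x - zh x))
      = ?I (?q uh) (weak_grad \<Omega> (\<lambda>x. z x - zh x)) - ?I (?q U) (weak_grad \<Omega> (\<lambda>x. z x - zh x))"
    unfolding zzh by (intro L2_inner_diff_left q weak_grad_H1 H1_lincomb \<Omega>' z' zh')
  also have "\<dots> = (?I (?q uh) (weak_grad \<Omega> z) - ?I (?q uh) (weak_grad \<Omega> zh))
      - (?I (?q U) (weak_grad \<Omega> z) - ?I (?q U) (weak_grad \<Omega> zh))"
    unfolding zzh using L2_inner_weak_grad_lincomb[OF \<Omega>' _ z' zh', of _ 1 "-1"] q by simp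
  finally have est: "?I (\<lambda>x. ?q uh x - ?q U x) (weak_grad \<Omega> (\<lambda>x. z x - zh x))
      = (?I (?q uh) (weak_grad \<Omega> z) - ?I (?q uh) (weak_grad \<Omega> zh))
        - (?I (?q U) (weak_grad \<Omega> z) - ?I (?q U) (weak_grad \<Omega> zh))" .
  \<comment> \<open>Trading the flux of \<open>U\<close> for \<open>f\<close> turns the excess of
    the estimate over the principal term into [(q(u), grad z) + (f, z)] +
    [-(q(uh), grad zh) - (f, zh)]; each bracket is nonnegative by one of the two facts that
    follow.\<close>
  have "- ?I (?q U) (weak_grad \<Omega> w) = ?I f w" if "w \<in> V_space \<Omega> \<Gamma>D (\<lambda>_. 0)" for w
    using U that by (simp add: unrestricted_solution_def L2_inner_minus_left)
  then have "- ?I (?q U) (weak_grad \<Omega> z) = ?I f z" "- ?I (?q U) (weak_grad \<Omega> zh) = ?I f zh"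
    using zV zhV by auto
  moreover have "0 \<le> ?I (?q u) (weak_grad \<Omega> z) + ?I f z"
    using normal_flux_pairing[OF parts u z' t(1,2)] contact_pairing[OF parts u uh' z' t(1,3)] by simp
  moreover have "?I f zh \<le> - ?I (?q uh) (weak_grad \<Omega> zh)"
    by (rule discrete_variational_ineq_Wh[OF \<Omega> mesh \<Gamma>A g uh zh])
  ultimately show ?thesis
    using J prin est by linarith
qed

theorem theorem4p7:
  fixes \<Omega> \<Gamma>A \<Gamma>N \<Gamma>D :: "(real ^ 'n) set"
    and up :: "real ^ 'n" and datum :: real
    and hz f gD u U qn :: "real ^ 'n \<Rightarrow> real"
    and k :: "real \<Rightarrow> real"
    and J :: "(real ^ 'n \<Rightarrow> real) \<Rightarrow> real"
    and T :: "'i \<Rightarrow> (real ^ 'n) set set"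
    and g uh z zh :: "'i \<Rightarrow> real ^ 'n \<Rightarrow> real"
    and C s :: real
  defines "hz \<equiv> height up datum"
  assumes dim: "CARD('n) = 2 \<or> CARD('n) = 3"
    and domain: "convex_polyhedral_domain \<Omega>" "boundary_parts \<Omega> \<Gamma>A \<Gamma>N \<Gamma>D"
    and data: "norm up = 1" "f \<in> L2_space (lebesgue_on \<Omega>)" "affine_data \<Gamma>D gD"
    and mesh: "\<And>i. conforming_mesh \<Omega> (T i)"
      "\<And>i. aligned_mesh \<Omega> (T i) \<Gamma>A" "\<And>i. aligned_mesh \<Omega> (T i) \<Gamma>D"
    and extension: "\<And>i. discrete_extension \<Omega> \<Gamma>A \<Gamma>D (T i) gD (g i)"
    and primal: "seepage_solution \<Omega> \<Gamma>A \<Gamma>N \<Gamma>D k hz f gD u qn"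
      "\<And>i. variational_ineq \<Omega> k hz f (K_space \<Omega> \<Gamma>A \<Gamma>D (\<lambda>_. 0)) (g i) u"
    and discrete: "\<And>i. discrete_solution \<Omega> \<Gamma>A \<Gamma>D (T i) k hz f gD (g i) (uh i)"
    and unrestricted: "unrestricted_solution \<Omega> \<Gamma>D k hz f gD U"
    and J: "linear_form_on \<Omega> (V_space \<Omega> \<Gamma>D (\<lambda>_. 0)) J"
    and dual: "\<And>i. dual_solution \<Omega> \<Gamma>A \<Gamma>D k u qn (uh i) J (z i)"
    and zh: "\<And>i. zh i \<in> Wh_space \<Omega> \<Gamma>D (T i) (contact_set \<Gamma>A (uh i)) (\<lambda>_. 0)"
    and L2_convergence: "C > 0" "s > 1"
      "\<And>i. L2_norm (lebesgue_on \<Omega>) (\<lambda>x. u x - uh i x) \<le> C * mesh_size (T i) powr s"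
  defines "h_to_0 \<equiv> filtercomap (\<lambda>i. mesh_size (T i)) (at_right 0)"
    and "err \<equiv> (\<lambda>i. J (\<lambda>x. u x - uh i x))"
    and "est \<equiv> (\<lambda>i. L2_inner (lebesgue_on \<Omega>) (\<lambda>x. flux \<Omega> k hz (uh i) x - flux \<Omega> k hz U x)
                      (weak_grad \<Omega> (\<lambda>x. z i x - zh i x)))"
    and "prin \<equiv> (\<lambda>i. principal_term \<Omega> k hz u (uh i) (z i))"
    and "negl \<equiv> (\<lambda>i. neglected_term \<Omega> k hz u (uh i) (z i))"
  shows "(\<forall>i. err i \<le> est i - negl i) \<and>
    (\<forall>i L. L-lipschitz_on UNIV k \<longrightarrow>
       (\<lambda>x. weak_grad \<Omega> (\<lambda>y. uh i y + hz y) x \<bullet> weak_grad \<Omega> (z i) x) \<in> L2_space (lebesgue_on \<Omega>) \<longrightarrow>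
       \<bar>negl i\<bar> \<le> L * C * mesh_size (T i) powr s *
         L2_norm (lebesgue_on \<Omega>)
           (\<lambda>x. weak_grad \<Omega> (\<lambda>y. uh i y + hz y) x \<bullet> weak_grad \<Omega> (z i) x)) \<and>
    (negl \<in> o[h_to_0](prin) \<longrightarrow> leading_order_le h_to_0 prin err est)"
proof -
  have \<Omega>: "open \<Omega>" "bounded \<Omega>"
    using domain(1) by (auto simp: convex_polyhedral_domain_def)
  have hz: "hz \<in> H1 \<Omega>"
    unfolding hz_def using \<Omega> by (rule height_in_H1)
  have err: "err i \<le> est i - negl i" for i
    unfolding err_def est_def negl_def
    by (rule error_le_estimate_minus_neglected[OF domain hz mesh(1,2) extension primal(1) discrete
          unrestricted dual zh])
  moreover have "\<bar>negl i\<bar> \<le> L * C * mesh_size (T i) powr s * L2_norm (lebesgue_on \<Omega>) G"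
    if L: "L-lipschitz_on UNIV k" and G: "G \<in> L2_space (lebesgue_on \<Omega>)"
      "G = (\<lambda>x. weak_grad \<Omega> (\<lambda>y. uh i y + hz y) x \<bullet> weak_grad \<Omega> (z i) x)" for i L G
  proof -
    have "u \<in> L2_space (lebesgue_on \<Omega>)" "uh i \<in> L2_space (lebesgue_on \<Omega>)"
      using primal(1) discrete[of i] by (auto simp: seepage_solution_def K_space_def H1_def
          discrete_solution_def Kh_space_def Vh_space_def V_space_def)
    from L2_space_lincomb[OF this, of 1 "-1"]
    have "(\<lambda>x. u x - uh i x) \<in> L2_space (lebesgue_on \<Omega>)"
      by simp
    from neglected_term_bound[OF L this G(1)[unfolded G(2)]]
    have "\<bar>negl i\<bar> \<le> L * L2_norm (lebesgue_on \<Omega>) (\<lambda>x. u x - uh i x) * L2_norm (lebesgue_on \<Omega>) G"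
      by (simp add: negl_def G(2))
    also have "\<dots> \<le> L * (C * mesh_size (T i) powr s) * L2_norm (lebesgue_on \<Omega>) G"
      using L2_convergence(3)[of i] lipschitz_on_nonneg[OF L]
      by (intro mult_right_mono mult_left_mono) (auto simp: L2_norm_def)
    finally show ?thesis by (simp add: mult.assoc)
  qed
  \<comment> \<open>The exact inequality holds for every index, so relative smallness of
    \<open>negl\<close> along the filter is all that the leading-order claim still requires.\<close>
  ultimately show ?thesis
    using leading_order_le_smallo[of negl h_to_0 prin err est] by blast
qed

end
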